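(* Let $D=d_1,\ldots,d_n$ and $F=f_1,\ldots,f_n$ be a pair of degree and neighbor degree sequences, and let $\Delta$ denote the largest degree in $D$. Then $(D,F)$ is tree realizable if and only if the integer programming feasibility problem $(\mathcal{X},\mathcal{L})$ has a solution, where $\mathcal{X}$ consists of all variables $x_\lambda$ for all partitions $\lambda=\lambda_1,\ldots,\lambda_{h(\lambda)}$ such that $h(\lambda)\le\Delta$ and $\lambda_i\le\Delta$ for all $i$, and auxiliary variables $p_1,\ldots,p_\Delta$, and $\mathcal{L}$ consists of - for all $d,f$ the equation $\sum_{\lambda\dashv f\,\wedge\,h(\lambda)=d}x_\lambda=y_{d,f}$, and $x_\lambda\ge 0$ for all $\lambda$, where $y_{d,f}$ is the number of indices $i$ with $d_i=d$ and $f_i=f$; - for all $1\le i<j\le\Delta$, the equation $\sum_{\lambda|h(\lambda)=i}x_\lambda N(\lambda,j)=\sum_{\lambda'|h(\lambda')=j}x_{\lambda'}N(\lambda',i)$; - for all $i$, the equation $\sum_{\lambda|h(\lambda)=i}x_\lambda N(\lambda,i)=2p_i$; - and for all subsets $\mathcal{I}\subseteq\{(i,j)\mid 1\le i\le j\le\Delta\}$, the inequality $$\sum_{(i,j)\in\mathcal{I}|i\ne j}\left(\sum_{\lambda|h(\lambda)=i}x_\lambda N(\lambda,j)+\sum_{\lambda|h(\lambda)=j}x_\lambda N(\lambda,i)\right)+\sum_{(i,i)\in\mathcal{I}}\ \sum_{\lambda|h(\lambda)=i}x_\lambda N(\lambda,i)\ \le\ 2\sum_\lambda x_\lambda\min\left\{1,\sum_{j|(h(\lambda),j)\in\mathcal{I}}N(\lambda,j)\right\}-2,$$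 where the pair $(h(\lambda),j)$ is regarded as unordered. Furthermore, $(D,F)$ has a caterpillar realization if a solution exists with $x_\lambda=0$ for all $\lambda$ for which $h(\lambda)>1$ and $\sum_{j>1}N(\lambda,j)>2$.
   Context: $D$ and $F$ are sequences of positive integers. $(D,F)$ is tree realizable (resp. has a caterpillar realization) if there is a tree (resp. caterpillar) on vertices $v_1,\ldots,v_n$ such that for all $k$, $d(v_k)=d_k$ and $\sum_{w\in\mathcal{N}(v_k)}d(w)=f_k$, where $d(v)$ is the degree and $\mathcal{N}(v)$ the set of neighbors of $v$. A caterpillar is a tree in which the non-leaf vertices form a path. An integer programming feasibility problem $(\mathcal{X},\mathcal{L})$ consists of a set $\mathcal{X}$ of indeterminates and a linear inequality system $\mathcal{L}$ in them, and asks whether there is an integer assignment to $\mathcal{X}$ satisfying $\mathcal{L}$. $\lambda\dashv f$ means that $\lambda$ is a partition of $f$ (a multiset of positive integers with sum $f$); its height $h(\lambda)$ is its number of parts; $N(\lambda,j)$ is the number of parts equal to $j$. The quantities $\min\{1,\cdot\}$ in the inequality are constants depending only on $\lambda$ and $\mathcal{I}$.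
   Formalization: The inequality is imposed only for those I with sum of x_λ·min{1,…} nonzero (otherwise it reads 0 ≤ −2, e.g. for I empty), and the condition d_1+…+d_n = 2(n−1) is required besides feasibility, in both parts (else D=F=(1,1,1,1) is feasible but no tree). *)

theory Defs
  imports Main "HOL-Library.Multiset"
begin

section \<open>Trees and caterpillars\<close>

text \<open>A finite simple graph is a finite vertex set together with a set of two-element edges.\<close>

definition simple_graph :: "'a set \<Rightarrow> 'a set set \<Rightarrow> bool" where
  "simple_graph V E \<longleftrightarrow> finite V \<and> (\<forall>e\<in>E. e \<subseteq> V \<and> card e = 2)"

definition nbrs :: "'a set set \<Rightarrow> 'a \<Rightarrow> 'a set" where
  "nbrs E v = {w. {v, w} \<in> E}"

definition deg :: "'a set set \<Rightarrow> 'a \<Rightarrow> nat" where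
  "deg E v = card (nbrs E v)"

definition connected_graph :: "'a set \<Rightarrow> 'a set set \<Rightarrow> bool" where
  "connected_graph V E \<longleftrightarrow>
     V \<noteq> {} \<and> (\<forall>u\<in>V. \<forall>v\<in>V. (u, v) \<in> {(a, b). {a, b} \<in> E}\<^sup>*)"

definition is_cycle :: "'a set set \<Rightarrow> 'a list \<Rightarrow> bool" where
  "is_cycle E vs \<longleftrightarrow> 3 \<le> length vs \<and> distinct vs \<and>
     (\<forall>i. Suc i < length vs \<longrightarrow> {vs ! i, vs ! Suc i} \<in> E) \<and> {last vs, hd vs} \<in> E"

definition is_tree :: "'a set \<Rightarrow> 'a set set \<Rightarrow> bool" where
  "is_tree V E \<longleftrightarrow> simple_graph V E \<and> connected_graph V E \<and> (\<nexists>vs. is_cycle E vs)"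

text \<open>
  The subgraph induced by the non-leaf vertices is a path with vertex sequence \<open>ps\<close>. The empty
  sequence is allowed, so the tree with a single edge is a caterpillar.
\<close>

definition is_caterpillar :: "'a set \<Rightarrow> 'a set set \<Rightarrow> bool" where
  "is_caterpillar V E \<longleftrightarrow> is_tree V E \<and>
     (\<exists>ps. distinct ps \<and> set ps = {v \<in> V. deg E v \<noteq> 1} \<and>
        {e \<in> E. e \<subseteq> set ps} = {{ps ! i, ps ! Suc i} | i. Suc i < length ps})"

text \<open>The vertex $v_{k+1}$ is the number \<open>k\<close>.\<close>

definition realizes :: "nat set set \<Rightarrow> nat list \<Rightarrow> nat list \<Rightarrow> bool" where
  "realizes E D F \<longleftrightarrow>
     (\<forall>k < length D. deg E k = D ! k \<and> (\<Sum>w\<in>nbrs E k. deg E w) = F ! k)"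

definition tree_realizable :: "nat list \<Rightarrow> nat list \<Rightarrow> bool" where
  "tree_realizable D F \<longleftrightarrow> (\<exists>E. is_tree {..<length D} E \<and> realizes E D F)"

definition caterpillar_realizable :: "nat list \<Rightarrow> nat list \<Rightarrow> bool" where
  "caterpillar_realizable D F \<longleftrightarrow> (\<exists>E. is_caterpillar {..<length D} E \<and> realizes E D F)"

section \<open>The integer program\<close>

definition partition_of :: "nat multiset \<Rightarrow> nat \<Rightarrow> bool" where
  "partition_of l f \<longleftrightarrow> 0 \<notin># l \<and> sum_mset l = f"

text \<open>
  The partitions that index the variables $x_\lambda$: height $h(\lambda)$ is \<open>size l\<close> and
  $N(\lambda, j)$ is \<open>count l j\<close>.
\<close>

definition parts_le :: "nat \<Rightarrow> nat multiset set" where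
  "parts_le \<Delta> = {l. (\<exists>f. partition_of l f) \<and> size l \<le> \<Delta> \<and> (\<forall>i\<in>#l. i \<le> \<Delta>)}"

definition y_count :: "nat list \<Rightarrow> nat list \<Rightarrow> nat \<Rightarrow> nat \<Rightarrow> nat" where
  "y_count D F d f = card {i. i < length D \<and> D ! i = d \<and> F ! i = f}"

definition half_edges :: "nat \<Rightarrow> (nat multiset \<Rightarrow> int) \<Rightarrow> nat \<Rightarrow> nat \<Rightarrow> int" where
  "half_edges \<Delta> x i j = (\<Sum>l\<in>{l \<in> parts_le \<Delta>. size l = i}. x l * int (count l j))"

definition pair_types :: "nat \<Rightarrow> (nat \<times> nat) set" where
  "pair_types \<Delta> = {(i, j). 1 \<le> i \<and> i \<le> j \<and> j \<le> \<Delta>}"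

definition touched :: "(nat \<times> nat) set \<Rightarrow> nat multiset \<Rightarrow> int" where
  "touched I l = min 1 (\<Sum>j\<in>{j. (size l, j) \<in> I \<or> (j, size l) \<in> I}. int (count l j))"

definition incident :: "nat \<Rightarrow> (nat multiset \<Rightarrow> int) \<Rightarrow> (nat \<times> nat) set \<Rightarrow> int" where
  "incident \<Delta> x I = (\<Sum>l\<in>parts_le \<Delta>. x l * touched I l)"

definition subset_ineq :: "nat \<Rightarrow> (nat multiset \<Rightarrow> int) \<Rightarrow> (nat \<times> nat) set \<Rightarrow> bool" where
  "subset_ineq \<Delta> x I \<longleftrightarrow>
     (\<Sum>(i, j)\<in>{(i, j) \<in> I. i \<noteq> j}. half_edges \<Delta> x i j + half_edges \<Delta> x j i)
       + (\<Sum>i\<in>{i. (i, i) \<in> I}. half_edges \<Delta> x i i)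
     \<le> 2 * incident \<Delta> x I - 2"

text \<open>
  The inequality bounds the number of edges of a forest with \<open>incident \<Delta> x I\<close> vertices, and so it
  can only be imposed when there is such a vertex: if no vertex has a neighbour of a type in \<open>I\<close>
  (for instance if \<open>I = {}\<close>), then it reads \<open>0 \<le> - 2\<close>, as shown next. Hence the guard
  \<open>incident \<Delta> x I \<noteq> 0\<close> in \<open>ip_solution\<close>.
\<close>

lemma subset_ineq_not_incident:
  assumes "\<forall>l\<in>parts_le \<Delta>. 0 \<le> x l" and "incident \<Delta> x I = 0"
  shows "\<not> subset_ineq \<Delta> x I"
proof -
  have nonneg: "0 \<le> half_edges \<Delta> x i j" for i j
    unfolding half_edges_def using assms(1) by (auto intro!: sum_nonneg)
  have "0 \<le> (\<Sum>(i, j)\<in>{(i, j) \<in> I. i \<noteq> j}. half_edges \<Delta> x i j + half_edges \<Delta> x j i)"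
    by (rule sum_nonneg) (auto intro!: add_nonneg_nonneg nonneg)
  moreover have "0 \<le> (\<Sum>i\<in>{i. (i, i) \<in> I}. half_edges \<Delta> x i i)"
    by (rule sum_nonneg) (rule nonneg)
  ultimately show ?thesis
    unfolding subset_ineq_def using assms(2) by linarith
qed

lemma not_subset_ineq_empty: "\<not> subset_ineq \<Delta> x {}"
  by (simp add: subset_ineq_def incident_def touched_def)

definition ip_solution ::
  "nat list \<Rightarrow> nat list \<Rightarrow> (nat multiset \<Rightarrow> int) \<Rightarrow> (nat \<Rightarrow> int) \<Rightarrow> bool" where
  "ip_solution D F x p \<longleftrightarrow> (let \<Delta> = Max (set D) in
     (\<forall>d f. (\<Sum>l\<in>{l \<in> parts_le \<Delta>. partition_of l f \<and> size l = d}. x l) = int (y_count D F d f)) \<and>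
     (\<forall>l\<in>parts_le \<Delta>. 0 \<le> x l) \<and>
     (\<forall>i j. 1 \<le> i \<and> i < j \<and> j \<le> \<Delta> \<longrightarrow> half_edges \<Delta> x i j = half_edges \<Delta> x j i) \<and>
     (\<forall>i. 1 \<le> i \<and> i \<le> \<Delta> \<longrightarrow> half_edges \<Delta> x i i = 2 * p i) \<and>
     (\<forall>I \<subseteq> pair_types \<Delta>. incident \<Delta> x I \<noteq> 0 \<longrightarrow> subset_ineq \<Delta> x I))"

text \<open>
  The inequalities bound numbers of edges only from above: for \<open>D = F = [1, 1, 1, 1]\<close> there is a
  solution, given by two disjoint edges, but no tree. Hence the number of edges of a tree has to be
  required separately.
\<close>

definition tree_degree_sum :: "nat list \<Rightarrow> bool" where
  "tree_degree_sum D \<longleftrightarrow> int (sum_list D) = 2 * (int (length D) - 1)"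

definition caterpillar_support :: "nat list \<Rightarrow> (nat multiset \<Rightarrow> int) \<Rightarrow> bool" where
  "caterpillar_support D x \<longleftrightarrow> (let \<Delta> = Max (set D) in
     \<forall>l\<in>parts_le \<Delta>. 1 < size l \<and> 2 < (\<Sum>j\<in>{j. 1 < j \<and> j \<le> \<Delta>}. count l j) \<longrightarrow> x l = 0)"

end

theory Submission
  imports Defs
begin

text \<open>
  A solution \<open>x\<close> prescribes for every \<open>\<lambda>\<close> how many vertices have the multiset \<open>\<lambda>\<close> of neighbour
  degrees. Once these multisets are distributed over the vertices, an entry \<open>j\<close> at a vertex \<open>v\<close> of
  degree \<open>d v\<close> is a half-edge of the unordered type \<open>{d v, j}\<close>. The equations say that the half-edges
  of each type can be paired off, and the inequality for \<open>I\<close> says that the edges with types in \<open>I\<close> are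
  fewer than the vertices that they touch. For a tree this is the bound for the forest formed by these
  edges (\<open>forest_demand_le\<close>), which makes the conditions necessary.

  The converse needs a pairing of the half-edges without cycles. The tree is grown edge by edge. The
  vertices carry labels that name the components of the graph built so far, and the inequalities are
  maintained with labels in place of vertices (\<open>demand_system\<close>). Adding an edge \<open>vw\<close> of type \<open>t\<close> merges
  two labels and uses up one edge. This can violate the inequality for \<open>I\<close> only if it held with
  equality before, that is, if \<open>I\<close> was tight, and only in two ways.

  \<^item> If \<open>t \<notin> I\<close>, then \<open>I\<close> touches both labels. The number of labels touched is submodular in \<open>I\<close>, so the
    tight sets that touch the label of \<open>v\<close> are closed under union. If every possible \<open>w\<close> were excluded in
    this way, then their union together with \<open>t\<close> would violate an inequality (\<open>partner_exists\<close>).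

  \<^item> If \<open>t \<in> I\<close>, then the new edge uses the last half-edges with types in \<open>I\<close> at both labels, so that
    the merged label is no longer touched. Tight sets that share an occurring type intersect in a tight
    set, so a minimal tight set \<open>J\<close> is contained in every tight set that shares a type with it. As \<open>J\<close> has
    as many half-edges as a tree on its labels, some label has two of them unless \<open>J\<close> stands for a single
    edge (\<open>tight_branching_label\<close>). It suffices to take \<open>v\<close> with such a label; if \<open>J\<close> is a single
    edge, then adding it exhausts the type \<open>t\<close>, and the inequality for \<open>I\<close> follows from the old one for
    \<open>I\<close> without \<open>t\<close>.

  Hence an edge can always be added (\<open>edge_exists\<close>). When no half-edge is left, the degree sum of a tree
  leaves exactly one label, so the graph is connected with one edge less than vertices and therefore
  acyclic.

  For the caterpillar, the support condition says that no non-leaf has more than two non-leaf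
  neighbours; then a longest path of non-leaves contains all of them (\<open>caterpillarI\<close>).
\<close>

section \<open>Paths, cycles and the number of edges\<close>

lemma simple_graph_edgeD:
  assumes "simple_graph V E" and "{v, w} \<in> E"
  shows "v \<in> V" and "w \<in> V" and "v \<noteq> w"
  using assms unfolding simple_graph_def by (auto dest!: bspec)

lemma simple_graph_finite_edges: "simple_graph V E \<Longrightarrow> finite E"
  unfolding simple_graph_def by (rule finite_subset[of _ "Pow V"]) auto

lemma nbrs_subset: "simple_graph V E \<Longrightarrow> nbrs E v \<subseteq> V"
  using simple_graph_edgeD(2) by (fastforce simp: nbrs_def)

lemma finite_nbrs: "simple_graph V E \<Longrightarrow> finite (nbrs E v)"
  using nbrs_subset finite_subset unfolding simple_graph_def by metis

text \<open>
  An edge, being a two-element set, is counted once in each direction.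
\<close>

lemma card_arcs:
  assumes "finite E" and "\<forall>e\<in>E. card e = 2"
  shows "finite {(v, w). {v, w} \<in> E} \<and> card {(v, w). {v, w} \<in> E} = 2 * card E"
  using assms
proof (induction E rule: finite_induct)
  case empty
  then show ?case by simp
next
  case (insert e E)
  then obtain a b where e: "e = {a, b}" "a \<noteq> b"
    by (auto simp: card_2_iff)
  have split: "{(v, w). {v, w} \<in> insert e E} = {(a, b), (b, a)} \<union> {(v, w). {v, w} \<in> E}"
    unfolding e(1) by (auto simp: doubleton_eq_iff)
  have disj: "{(a, b), (b, a)} \<inter> {(v, w). {v, w} \<in> E} = {}"
    using insert.hyps(2) e(1) by (auto simp: insert_commute)
  have IH: "finite {(v, w). {v, w} \<in> E}" "card {(v, w). {v, w} \<in> E} = 2 * card E"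
    using insert by auto
  have "card {(v, w). {v, w} \<in> insert e E} = card {(a, b), (b, a)} + card {(v, w). {v, w} \<in> E}"
    unfolding split by (rule card_Un_disjoint) (use IH disj in auto)
  then show ?case
    using IH e(2) insert.hyps split by auto
qed

lemma rtrancl_leaves_set:
  assumes "(u, z) \<in> R\<^sup>*" and "u \<in> W" and "z \<notin> W"
  shows "\<exists>x y. x \<in> W \<and> y \<notin> W \<and> (x, y) \<in> R"
  using assms by (induction rule: rtrancl_induct) blast+

text \<open>
  A largest nonempty vertex set \<open>W\<close> that spans at least \<open>card W - 1\<close> edges is all of \<open>V\<close>, because
  otherwise connectivity provides an edge that leaves \<open>W\<close>, and its endpoint could be added.
\<close>

lemma connected_card_le:
  assumes simple: "simple_graph V E" and conn: "connected_graph V E"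
  shows "card V \<le> card E + 1"
proof -
  define good where "good W \<longleftrightarrow> W \<subseteq> V \<and> W \<noteq> {} \<and> card W \<le> card {e \<in> E. e \<subseteq> W} + 1" for W
  have finV: "finite V" and finE: "finite E"
    using simple simple_graph_finite_edges unfolding simple_graph_def by auto
  obtain a where "a \<in> V" using conn unfolding connected_graph_def by blast
  then have "good {a}" by (auto simp: good_def)
  moreover have "\<forall>W. good W \<longrightarrow> card W < Suc (card V)"
    using finV by (auto simp: good_def card_mono less_Suc_eq_le)
  ultimately obtain W where W: "good W" and max: "\<And>W'. good W' \<Longrightarrow> card W' \<le> card W"
    using ex_has_greatest_nat[of good "{a}" card "Suc (card V)"] by blast
  have "W = V"
  proof (rule ccontr)
    assume "W \<noteq> V"
    then obtain u z where uz: "u \<in> W" "z \<in> V" "z \<notin> W" "u \<in> V"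
      using W unfolding good_def by blast
    then have "(u, z) \<in> {(a, b). {a, b} \<in> E}\<^sup>*"
      using conn unfolding connected_graph_def by blast
    then obtain x y where xy: "x \<in> W" "y \<notin> W" "{x, y} \<in> E"
      using rtrancl_leaves_set[OF _ uz(1,3)] by blast
    have finW: "finite W" using W finV finite_subset unfolding good_def by auto
    have "card (insert {x, y} {e \<in> E. e \<subseteq> W}) \<le> card {e \<in> E. e \<subseteq> insert y W}"
      by (rule card_mono) (use finE xy in auto)
    then have "card {e \<in> E. e \<subseteq> W} + 1 \<le> card {e \<in> E. e \<subseteq> insert y W}"
      using finE xy(2) by simp
    then have "good (insert y W)"
      using W finW xy simple_graph_edgeD[OF simple xy(3)] unfolding good_def by auto
    then show False using max[of "insert y W"] finW xy(2) by simp
  qed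
  moreover have "card {e \<in> E. e \<subseteq> W} \<le> card E"
    by (rule card_mono) (use finE in auto)
  ultimately show ?thesis using W unfolding good_def by simp
qed

lemma is_cycle_mono: "is_cycle E vs \<Longrightarrow> E \<subseteq> E' \<Longrightarrow> is_cycle E' vs"
  unfolding is_cycle_def by blast

text \<open>
  An edge of a cycle can be removed without losing connectivity, which would leave too few edges for
  \<open>connected_card_le\<close>.
\<close>

lemma connected_few_edges_acyclic:
  assumes simple: "simple_graph V E" and conn: "connected_graph V E"
    and few: "card E + 1 \<le> card V"
  shows "\<not> is_cycle E vs"
proof
  assume cyc: "is_cycle E vs"
  let ?e = "{last vs, hd vs}"
  let ?R = "\<lambda>E. {(a, b). {a, b} \<in> E}"
  let ?E = "E - {?e}"
  have len: "3 \<le> length vs" and dist: "distinct vs" and eE: "?e \<in> E"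
    and adj: "\<And>i. Suc i < length vs \<Longrightarrow> {vs ! i, vs ! Suc i} \<in> E"
    using cyc unfolding is_cycle_def by auto
  have hd: "hd vs = vs ! 0" and last: "last vs = vs ! (length vs - 1)"
    using len by (cases "vs = []"; simp add: hd_conv_nth last_conv_nth)+
  have adj': "{vs ! i, vs ! Suc i} \<in> ?E" if "Suc i < length vs" for i
  proof -
    have "{vs ! i, vs ! Suc i} \<noteq> ?e"
    proof
      assume "{vs ! i, vs ! Suc i} = ?e"
      then consider "vs ! i = vs ! (length vs - 1)" | "vs ! i = vs ! 0" "vs ! Suc i = vs ! (length vs - 1)"
        unfolding hd last by (auto simp: doubleton_eq_iff)
      then show False
      proof cases
        case 1
        then have "i = length vs - 1"
          using nth_eq_iff_index_eq[OF dist, of i "length vs - 1"] that by linarith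
        then show ?thesis using that by simp
      next
        case 2
        then have "i = 0" "Suc i = length vs - 1"
          using nth_eq_iff_index_eq[OF dist, of i 0]
            nth_eq_iff_index_eq[OF dist, of "Suc i" "length vs - 1"] that by linarith+
        then show ?thesis using len by simp
      qed
    qed
    then show ?thesis using adj[OF that] by simp
  qed
  have sym: "sym ((?R ?E)\<^sup>*)"
    by (rule sym_rtrancl) (auto simp: sym_def insert_commute)
  have walk: "i < length vs \<Longrightarrow> (vs ! 0, vs ! i) \<in> (?R ?E)\<^sup>*" for i
  proof (induction i)
    case (Suc i)
    then have "(vs ! i, vs ! Suc i) \<in> ?R ?E" using adj' by simp
    then show ?case using Suc by (meson Suc_lessD rtrancl.rtrancl_into_rtrancl)
  qed simp
  have closing: "(hd vs, last vs) \<in> (?R ?E)\<^sup>*" "(last vs, hd vs) \<in> (?R ?E)\<^sup>*"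
    using walk[of "length vs - 1"] len symD[OF sym] unfolding hd last by auto
  have "?R E \<subseteq> (?R ?E)\<^sup>*"
  proof clarify
    fix a b assume "{a, b} \<in> E"
    then show "(a, b) \<in> (?R ?E)\<^sup>*"
      using closing by (cases "{a, b} = ?e") (auto simp: doubleton_eq_iff)
  qed
  then have "(?R E)\<^sup>* \<subseteq> (?R ?E)\<^sup>*" by (rule rtrancl_subset_rtrancl)
  then have "connected_graph V ?E"
    using conn unfolding connected_graph_def by blast
  moreover have "simple_graph V ?E" using simple unfolding simple_graph_def by auto
  ultimately have "card V \<le> card ?E + 1" by (rule connected_card_le[rotated])
  moreover have "card ?E < card E"
    by (rule card_Diff1_less[OF simple_graph_finite_edges[OF simple] eE])
  ultimately show False using few by linarith
qed

definition is_path :: "'a set set \<Rightarrow> 'a list \<Rightarrow> bool" where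
  "is_path E ps \<longleftrightarrow> distinct ps \<and> (\<forall>i. Suc i < length ps \<longrightarrow> {ps ! i, ps ! Suc i} \<in> E)"

lemma is_path_Cons:
  assumes "is_path E ps" and "ps \<noteq> []" and "{y, ps ! 0} \<in> E" and "y \<notin> set ps"
  shows "is_path E (y # ps)"
  using assms unfolding is_path_def by (auto simp: nth_Cons split: nat.split)

lemma is_path_snoc:
  assumes "is_path E ps" and "ps \<noteq> []" and "{ps ! (length ps - 1), y} \<in> E" and "y \<notin> set ps"
  shows "is_path E (ps @ [y])"
proof -
  have "{(ps @ [y]) ! i, (ps @ [y]) ! Suc i} \<in> E" if "i < length ps" for i
  proof (cases "Suc i < length ps")
    case True
    then show ?thesis using assms(1) that by (simp add: is_path_def nth_append)
  next
    case False
    then have "i = length ps - 1" using that by simp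
    then show ?thesis using assms(2,3) that by (simp add: nth_append)
  qed
  then show ?thesis using assms(1,4) by (auto simp: is_path_def)
qed

text \<open>
  Otherwise the chord closes the segment of the path between its endpoints to a cycle.
\<close>

lemma acyclic_path_no_chord:
  assumes acyc: "\<nexists>vs. is_cycle E vs" and path: "is_path E ps"
    and ij: "i < j" "j < length ps" and edge: "{ps ! i, ps ! j} \<in> E"
  shows "j = Suc i"
proof (rule ccontr)
  assume "j \<noteq> Suc i"
  let ?vs = "drop i (take (Suc j) ps)"
  have len: "length ?vs = Suc j - i" using ij by simp
  have nth: "?vs ! k = ps ! (i + k)" if "k < Suc j - i" for k
    using that ij by simp
  have ne: "?vs \<noteq> []" using ij by simp
  have "is_cycle E ?vs"
    unfolding is_cycle_def
  proof (intro conjI allI impI)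
    show "3 \<le> length ?vs" using \<open>j \<noteq> Suc i\<close> ij len by linarith
    show "distinct ?vs" using path unfolding is_path_def by simp
    have "hd ?vs = ps ! i" "last ?vs = ps ! j"
      using ij ne by (auto simp: hd_drop_conv_nth take_Suc_conv_app_nth)
    then show "{last ?vs, hd ?vs} \<in> E" using edge by (simp add: insert_commute)
  next
    fix k assume "Suc k < length ?vs"
    then show "{?vs ! k, ?vs ! Suc k} \<in> E"
      using nth path ij unfolding len is_path_def by auto
  qed
  then show False using acyc by blast
qed

lemma longest_path_exists:
  assumes "finite W" and "W \<noteq> {}"
  obtains ps where "ps \<noteq> []" and "set ps \<subseteq> W" and "is_path E ps"
    and "\<And>qs. set qs \<subseteq> W \<Longrightarrow> is_path E qs \<Longrightarrow> length qs \<le> length ps"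
proof -
  let ?good = "\<lambda>ps. set ps \<subseteq> W \<and> is_path E ps"
  obtain a where "a \<in> W" using assms(2) by blast
  then have a: "?good [a]" by (simp add: is_path_def)
  have "\<forall>ps. ?good ps \<longrightarrow> length ps < Suc (card W)"
    unfolding is_path_def using assms(1)
    by (metis card_mono distinct_card less_Suc_eq_le)
  then obtain ps where ps: "?good ps" and max: "\<And>qs. ?good qs \<Longrightarrow> length qs \<le> length ps"
    using ex_has_greatest_nat[of ?good "[a]" length "Suc (card W)"] a by blast
  have "ps \<noteq> []" using max[OF a] by auto
  then show thesis using that ps max by blast
qed

text \<open>
  All neighbours of the first vertex of a longest path lie on the path, so without cycles the second
  vertex is the only one. The bound follows by induction, removing the first vertex with its edge.
\<close>

lemma acyclic_card_le:
  assumes "simple_graph V E" and "\<nexists>vs. is_cycle E vs" and "V \<noteq> {}"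
  shows "card E + 1 \<le> card V"
  using assms
proof (induction "card V" arbitrary: V E rule: less_induct)
  case less
  note simple = less.prems(1) and acyc = less.prems(2)
  have finV: "finite V" using simple unfolding simple_graph_def by simp
  obtain ps where ps: "ps \<noteq> []" "set ps \<subseteq> V" "is_path E ps"
    and max: "\<And>qs. set qs \<subseteq> V \<Longrightarrow> is_path E qs \<Longrightarrow> length qs \<le> length ps"
    using longest_path_exists[OF finV less.prems(3)] by blast
  define v where "v = ps ! 0"
  have vV: "v \<in> V" using ps by (auto simp: v_def)
  have one: "w = ps ! 1" if "{v, w} \<in> E" for w
  proof -
    have "w \<in> set ps"
    proof (rule ccontr)
      assume "w \<notin> set ps"
      then have "is_path E (w # ps)"
        using is_path_Cons[OF ps(3,1)] that by (simp add: v_def insert_commute)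
      then show False
        using max[of "w # ps"] ps(2) simple_graph_edgeD[OF simple that] by simp
    qed
    then obtain j where j: "j < length ps" "w = ps ! j" by (auto simp: in_set_conv_nth)
    moreover have "0 < j"
      using simple_graph_edgeD(3)[OF simple that] j by (cases j) (auto simp: v_def)
    ultimately show ?thesis
      using acyclic_path_no_chord[OF acyc ps(3), of 0 j] that by (simp add: v_def)
  qed
  let ?E = "{e \<in> E. v \<notin> e}"
  have finE: "finite E" using simple_graph_finite_edges[OF simple] .
  have "E \<subseteq> insert {v, ps ! 1} ?E"
  proof
    fix e assume e: "e \<in> E"
    show "e \<in> insert {v, ps ! 1} ?E"
    proof (cases "v \<in> e")
      case True
      then obtain w where "e = {v, w}"
        using simple e unfolding simple_graph_def by (fastforce simp: card_2_iff)
      then show ?thesis using one e by auto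
    qed (use e in simp)
  qed
  then have "card E \<le> card (insert {v, ps ! 1} ?E)"
    using finE by (intro card_mono) auto
  also have "\<dots> \<le> card ?E + 1" using finE by (simp add: card_insert_if)
  finally have cE: "card E \<le> card ?E + 1" .
  have cV: "card V = card (V - {v}) + 1"
    using finV vV card_Suc_Diff1 by fastforce
  show ?case
  proof (cases "V = {v}")
    case True
    then have "E = {}"
      using simple unfolding simple_graph_def by (fastforce simp: subset_singleton_iff)
    then show ?thesis using True by simp
  next
    case False
    have "simple_graph (V - {v}) ?E" using simple unfolding simple_graph_def by auto
    moreover have "\<nexists>vs. is_cycle ?E vs"
      using acyc is_cycle_mono[of ?E _ E] by blast
    moreover have "V - {v} \<noteq> {}" "card (V - {v}) < card V" using False vV cV by auto
    ultimately have "card ?E + 1 \<le> card (V - {v})"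
      by (intro less.hyps)
    then show ?thesis using cE cV by simp
  qed
qed

text \<open>
  The non-leaves on a longest path \<open>ps\<close> of non-leaves have no further non-leaf neighbour: an inner
  vertex of \<open>ps\<close> already has two, and at an end the path could be prolonged. A leaf leads only back to
  where it is attached, so by connectivity there are no other non-leaves.
\<close>

lemma caterpillarI:
  assumes tree: "is_tree V E"
    and two: "\<And>v. v \<in> V \<Longrightarrow> deg E v \<noteq> 1 \<Longrightarrow> card {w \<in> nbrs E v. deg E w \<noteq> 1} \<le> 2"
  shows "is_caterpillar V E"
proof -
  define W where "W = {v \<in> V. deg E v \<noteq> 1}"
  have simple: "simple_graph V E" and acyc: "\<nexists>vs. is_cycle E vs"
    and conn: "connected_graph V E"
    using tree unfolding is_tree_def by auto
  have card2: "card e = 2" if "e \<in> E" for e using that simple unfolding simple_graph_def by simp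
  show ?thesis
  proof (cases "W = {}")
    case True
    have "{e \<in> E. e \<subseteq> set []} = {}" using card2 by fastforce
    then show ?thesis
      using tree True unfolding is_caterpillar_def W_def by (intro conjI exI[of _ "[]"]) auto
  next
    case False
    have finW: "finite W" using simple unfolding simple_graph_def W_def by simp
    obtain ps where ps: "ps \<noteq> []" "set ps \<subseteq> W" "is_path E ps"
      and max: "\<And>qs. set qs \<subseteq> W \<Longrightarrow> is_path E qs \<Longrightarrow> length qs \<le> length ps"
      using longest_path_exists[OF finW False] by blast
    have dist: "distinct ps" and adj: "\<And>i. Suc i < length ps \<Longrightarrow> {ps ! i, ps ! Suc i} \<in> E"
      using ps(3) unfolding is_path_def by auto
    have closed: "y \<in> set ps" if x: "x \<in> set ps" and y: "y \<in> W" and xy: "{x, y} \<in> E" for x y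
    proof (rule ccontr)
      assume ny: "y \<notin> set ps"
      obtain i where i: "i < length ps" "x = ps ! i" using x by (auto simp: in_set_conv_nth)
      have "i \<noteq> 0"
      proof
        assume "i = 0"
        then have "is_path E (y # ps)"
          using is_path_Cons[OF ps(3,1) _ ny] xy i by (simp add: insert_commute)
        then show False using max[of "y # ps"] ps(2) y by simp
      qed
      moreover have "Suc i < length ps"
      proof (rule ccontr)
        assume "\<not> Suc i < length ps"
        then have "i = length ps - 1" using i by simp
        then have "is_path E (ps @ [y])"
          using is_path_snoc[OF ps(3,1) _ ny] xy i by simp
        then show False using max[of "ps @ [y]"] ps(2) y by simp
      qed
      moreover have "{ps ! (i - 1), x} \<in> E"
        using adj[of "i - 1"] calculation i by simp
      moreover have "{x, ps ! Suc i} \<in> E"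
        using adj[of i] calculation i by simp
      moreover have "ps ! (i - 1) \<noteq> ps ! Suc i"
        using calculation dist by (simp add: nth_eq_iff_index_eq)
      moreover have "ps ! (i - 1) \<in> set ps" "ps ! Suc i \<in> set ps"
        using calculation i by auto
      moreover have "y \<noteq> ps ! (i - 1)" "y \<noteq> ps ! Suc i" using calculation ny by auto
      moreover have "ps ! (i - 1) \<in> W" "ps ! Suc i \<in> W" using calculation ps(2) by blast+
      ultimately have sub: "{ps ! (i - 1), ps ! Suc i, y} \<subseteq> {w \<in> nbrs E x. deg E w \<noteq> 1}"
        and c3: "card {ps ! (i - 1), ps ! Suc i, y} = 3"
        using xy y unfolding nbrs_def W_def by (simp_all add: insert_commute)
      have "3 \<le> card {w \<in> nbrs E x. deg E w \<noteq> 1}"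
        using card_mono[OF _ sub] c3 finite_nbrs[OF simple, of x] by simp
      moreover have "x \<in> V" "deg E x \<noteq> 1" using x ps(2) unfolding W_def by auto
      ultimately show False using two[of x] by simp
    qed
    have reach: "z \<in> set ps \<or> (deg E z = 1 \<and> nbrs E z \<inter> set ps \<noteq> {})"
      if "(ps ! 0, z) \<in> {(a, b). {a, b} \<in> E}\<^sup>*" for z
      using that
    proof (induction rule: rtrancl_induct)
      case base
      then show ?case using ps(1) by simp
    next
      case (step y z)
      then have yz: "{y, z} \<in> E" by simp
      then have zV: "z \<in> V" using simple_graph_edgeD[OF simple] by blast
      show ?case
      proof (cases "y \<in> set ps")
        case True
        then have "y \<in> nbrs E z \<inter> set ps" using yz by (simp add: nbrs_def insert_commute)
        then show ?thesis using closed[OF True _ yz] zV unfolding W_def by blast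
      next
        case False
        then have "deg E y = 1" "nbrs E y \<inter> set ps \<noteq> {}" using step.IH by auto
        moreover have "z \<in> nbrs E y" using yz by (simp add: nbrs_def)
        ultimately show ?thesis unfolding deg_def by (auto simp: card_1_singleton_iff)
      qed
    qed
    have "ps ! 0 \<in> V" using ps(1,2) nth_mem[of 0 ps] unfolding W_def by blast
    then have setps: "set ps = W"
      using reach conn ps(2) unfolding connected_graph_def W_def by blast
    have "{e \<in> E. e \<subseteq> set ps} = {{ps ! i, ps ! Suc i} | i. Suc i < length ps}" (is "?A = ?B")
    proof
      show "?B \<subseteq> ?A" using adj by fastforce
      show "?A \<subseteq> ?B"
      proof
        fix e assume "e \<in> ?A"
        then have e: "e \<in> E" "e \<subseteq> set ps" by auto
        then obtain a b where ab: "e = {a, b}" "a \<noteq> b" using card2[of e] unfolding card_2_iff by blast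
        then have "a \<in> set ps" "b \<in> set ps" using e(2) by auto
        then obtain i j where ij: "i < length ps" "j < length ps" "a = ps ! i" "b = ps ! j"
          unfolding in_set_conv_nth by blast
        then consider "i < j" | "j < i" using ab(2) by (metis linorder_neqE_nat)
        then show "e \<in> ?B"
        proof cases
          case 1
          then have "j = Suc i" using acyclic_path_no_chord[OF acyc ps(3) 1] e ab ij by simp
          then show ?thesis using ab ij by blast
        next
          case 2
          then have "i = Suc j"
            using acyclic_path_no_chord[OF acyc ps(3) 2] e ab ij by (simp add: insert_commute)
          then show ?thesis using ab ij by (auto simp: insert_commute)
        qed
      qed
    qed
    then show ?thesis
      using tree dist setps unfolding is_caterpillar_def W_def by blast
  qed
qed

section \<open>Demands and their types\<close>

text \<open>
  An entry \<open>j\<close> of \<open>m v\<close> is a half-edge at \<open>v\<close> that still has to be joined to a half-edge \<open>d v\<close> at a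
  vertex of prescribed degree \<open>j\<close>. Its type is the unordered pair of the two degrees, written with
  the smaller one first, as in \<open>pair_types\<close>.
\<close>

definition pair_type :: "nat \<Rightarrow> nat \<Rightarrow> nat \<times> nat" where
  "pair_type a b = (min a b, max a b)"

definition demand :: "('a \<Rightarrow> nat) \<Rightarrow> ('a \<Rightarrow> nat multiset) \<Rightarrow> (nat \<times> nat) set \<Rightarrow> 'a \<Rightarrow> nat" where
  "demand d m I v = size {#j \<in># m v. pair_type (d v) j \<in> I#}"

definition total_demand ::
  "'a set \<Rightarrow> ('a \<Rightarrow> nat) \<Rightarrow> ('a \<Rightarrow> nat multiset) \<Rightarrow> (nat \<times> nat) set \<Rightarrow> nat" where
  "total_demand V d m I = (\<Sum>v\<in>V. demand d m I v)"

definition touching ::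
  "'a set \<Rightarrow> ('a \<Rightarrow> nat) \<Rightarrow> ('a \<Rightarrow> nat multiset) \<Rightarrow> (nat \<times> nat) set \<Rightarrow> 'a set" where
  "touching V d m I = {v \<in> V. demand d m I v \<noteq> 0}"

definition half_demand ::
  "'a set \<Rightarrow> ('a \<Rightarrow> nat) \<Rightarrow> ('a \<Rightarrow> nat multiset) \<Rightarrow> nat \<Rightarrow> nat \<Rightarrow> nat" where
  "half_demand V d m i j = (\<Sum>v\<in>{v \<in> V. d v = i}. count (m v) j)"

lemma pair_type_commute: "pair_type a b = pair_type b a"
  by (simp add: pair_type_def min.commute max.commute)

lemma pair_type_eq_iff:
  "pair_type a b = pair_type i j \<longleftrightarrow> (a = i \<and> b = j) \<or> (a = j \<and> b = i)"
  unfolding pair_type_def by (auto simp: min_def max_def split: if_splits)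

lemma demand_eq_0_iff: "demand d m I v = 0 \<longleftrightarrow> (\<forall>j\<in>#m v. pair_type (d v) j \<notin> I)"
  unfolding demand_def size_eq_0_iff_empty set_mset_eq_empty_iff[symmetric] by auto

lemma touching_iff: "v \<in> touching V d m I \<longleftrightarrow> v \<in> V \<and> (\<exists>j\<in>#m v. pair_type (d v) j \<in> I)"
  unfolding touching_def by (auto simp: demand_eq_0_iff)

lemma touching_subset: "touching V d m I \<subseteq> V"
  unfolding touching_def by auto

lemma touching_Un: "touching V d m (I \<union> J) = touching V d m I \<union> touching V d m J"
  by (auto simp: touching_iff)

lemma touching_mono: "I \<subseteq> J \<Longrightarrow> touching V d m I \<subseteq> touching V d m J"
  unfolding touching_iff subset_iff by blast

lemma demand_mono: "I \<subseteq> J \<Longrightarrow> demand d m I v \<le> demand d m J v"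
  unfolding demand_def
  by (intro size_mset_mono mset_subset_eqI) auto

lemma demand_Un_Int:
  "demand d m (I \<union> J) v + demand d m (I \<inter> J) v = demand d m I v + demand d m J v"
proof -
  have "size {#j \<in># M. P j \<or> Q j#} + size {#j \<in># M. P j \<and> Q j#} =
      size {#j \<in># M. P j#} + size {#j \<in># M. Q j#}" for M :: "nat multiset" and P Q
    by (induction M) auto
  then show ?thesis by (simp add: demand_def)
qed

lemma total_demand_Un_Int:
  "total_demand V d m (I \<union> J) + total_demand V d m (I \<inter> J) =
    total_demand V d m I + total_demand V d m J"
  unfolding total_demand_def by (simp add: demand_Un_Int flip: sum.distrib)

lemma total_demand_empty [simp]: "total_demand V d m {} = 0"
  by (simp add: total_demand_def demand_def)

lemma total_demand_Un_disjoint: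
  "I \<inter> J = {} \<Longrightarrow> total_demand V d m (I \<union> J) = total_demand V d m I + total_demand V d m J"
  using total_demand_Un_Int[of V d m I J] by simp

lemma total_demand_eq_0_iff:
  "finite V \<Longrightarrow> total_demand V d m I = 0 \<longleftrightarrow> touching V d m I = {}"
  unfolding total_demand_def touching_def by auto

lemma demand_pair_type:
  "demand d m {pair_type i j} v =
    (if d v = i then count (m v) j else 0) + (if d v = j \<and> i \<noteq> j then count (m v) i else 0)"
proof -
  have "{#k \<in># m v. pair_type (d v) k \<in> {pair_type i j}#} =
     (if d v = i then {#k \<in># m v. k = j#} else if d v = j then {#k \<in># m v. k = i#} else {#})"
    by (intro multiset_eqI) (auto simp: pair_type_eq_iff)
  then show ?thesis unfolding demand_def by (auto simp: filter_eq_replicate_mset)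
qed

text \<open>
  Off the diagonal the half-edges of a type lie on two sides, on the diagonal there is only one.
\<close>

lemma total_demand_pair_type:
  assumes "finite V"
  shows "total_demand V d m {pair_type i j} =
    half_demand V d m i j + (if i \<noteq> j then half_demand V d m j i else 0)"
  using assms unfolding total_demand_def demand_pair_type half_demand_def
  by (simp add: sum.distrib sum.If_cases Int_def conj_commute)

lemma demand_not_sorted: "j < i \<Longrightarrow> demand d m {(i, j)} v = 0"
  by (auto simp: demand_eq_0_iff pair_type_def)

lemma total_demand_sum: "finite I \<Longrightarrow> total_demand V d m I = (\<Sum>t\<in>I. total_demand V d m {t})"
proof (induction I rule: finite_induct)
  case (insert t I)
  then show ?case using total_demand_Un_disjoint[of "{t}" I V d m] by simp
qed simp

lemma even_total_demand:
  assumes "finite V" and "finite I"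
    and "\<And>i j. half_demand V d m i j = half_demand V d m j i"
    and "\<And>i. even (half_demand V d m i i)"
  shows "even (total_demand V d m I)"
  unfolding total_demand_sum[OF assms(2)]
proof (rule dvd_sum)
  fix t :: "nat \<times> nat"
  obtain i j where t: "t = (i, j)" by force
  show "even (total_demand V d m {t})"
  proof (cases "i \<le> j")
    case True
    then have "t = pair_type i j" by (simp add: t pair_type_def)
    then show ?thesis using assms by (simp add: total_demand_pair_type assms(3)[of j i])
  next
    case False
    then show ?thesis by (simp add: t total_demand_def demand_not_sorted)
  qed
qed

section \<open>Adding one edge\<close>

text \<open>
  The demands that remain after the edge \<open>vw\<close> is added. The updates are independent only for \<open>v\<close> and \<open>w\<close>
  distinct, which holds for vertices with different labels.
\<close>

definition serve :: "'a \<Rightarrow> 'a \<Rightarrow> ('a \<Rightarrow> nat) \<Rightarrow> ('a \<Rightarrow> nat multiset) \<Rightarrow> 'a \<Rightarrow> nat multiset" where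
  "serve v w d m = m(v := m v - {#d w#}, w := m w - {#d v#})"

definition merge :: "'b \<Rightarrow> 'b \<Rightarrow> ('a \<Rightarrow> 'b) \<Rightarrow> 'a \<Rightarrow> 'b" where
  "merge a b c x = (if c x = b then a else c x)"

lemma card_merge_image_both:
  assumes "finite X" and "a \<noteq> b" and "a \<in> c ` X" and "b \<in> c ` X"
  shows "card (merge a b c ` X) = card (c ` X) - 1"
proof -
  have "merge a b c ` X = c ` X - {b}"
    using assms(2,3) by (auto simp: merge_def image_iff)
  then show ?thesis using assms by (simp add: card_Diff_singleton)
qed

lemma card_merge_image_not_both:
  assumes "\<not> (a \<in> c ` X \<and> b \<in> c ` X)"
  shows "card (merge a b c ` X) = card (c ` X)"
proof -
  have "merge a b c ` X = (\<lambda>y. if y = b then a else y) ` (c ` X)"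
    by (auto simp: merge_def image_image)
  moreover have "inj_on (\<lambda>y. if y = b then a else y) (c ` X)" using assms by (auto simp: inj_on_def)
  ultimately show ?thesis by (simp only: card_image)
qed

text \<open>
  A partially built graph, seen through its remaining demands \<open>m\<close> and a label \<open>c v\<close> for the component
  of each vertex. The assumption \<open>hall\<close> is the inequality of the integer program, counting half-edges
  and labels instead of edges and vertices, and \<open>spanning\<close> says that the remaining edges are exactly
  as many as needed to connect the labels to a tree.
\<close>

locale demand_system =
  fixes V :: "'a set" and d :: "'a \<Rightarrow> nat" and P :: "(nat \<times> nat) set"
    and m :: "'a \<Rightarrow> nat multiset" and c :: "'a \<Rightarrow> 'b"
  assumes finite_V: "finite V" and finite_P: "finite P"
    and types: "\<And>v j. v \<in> V \<Longrightarrow> j \<in># m v \<Longrightarrow> pair_type (d v) j \<in> P"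
    and half_sym: "\<And>i j. half_demand V d m i j = half_demand V d m j i"
    and half_even: "\<And>i. even (half_demand V d m i i)"
    and hall: "\<And>I. I \<subseteq> P \<Longrightarrow> touching V d m I \<noteq> {} \<Longrightarrow>
      total_demand V d m I + 2 \<le> 2 * card (c ` touching V d m I)"
    and spanning: "total_demand V d m P + 2 = 2 * card (c ` V)"
begin

abbreviation "H \<equiv> total_demand V d m"
abbreviation "labels I \<equiv> c ` touching V d m I"

definition tight :: "(nat \<times> nat) set \<Rightarrow> bool" where
  "tight I \<longleftrightarrow> I \<subseteq> P \<and> touching V d m I \<noteq> {} \<and> H I + 2 = 2 * card (labels I)"

lemma finite_touching [simp]: "finite (touching V d m I)"
  using finite_V unfolding touching_def by simp


lemma H_even: "I \<subseteq> P \<Longrightarrow> even (H I)"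
  using even_total_demand[OF finite_V finite_subset[OF _ finite_P] half_sym half_even] .

lemma labels_Un: "labels (I \<union> J) = labels I \<union> labels J"
  by (simp add: touching_Un image_Un)

lemma labels_Int: "labels (I \<inter> J) \<subseteq> labels I \<inter> labels J"
  using touching_mono[of "I \<inter> J" I V d m] touching_mono[of "I \<inter> J" J V d m] by blast

text \<open>
  The right-hand side of \<open>hall\<close> is submodular in \<open>I\<close> and the left-hand side is modular, up to the constant,
  which occurs equally often on both sides because \<open>I\<close> and \<open>J\<close> share an occurring type.
\<close>

lemma tight_Int:
  assumes I: "tight I" and J: "tight J" and ne: "touching V d m (I \<inter> J) \<noteq> {}"
  shows "tight (I \<inter> J)"
proof -
  have sub: "I \<union> J \<subseteq> P" "I \<inter> J \<subseteq> P" using I J unfolding tight_def by auto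
  have ne': "touching V d m (I \<union> J) \<noteq> {}" using I unfolding tight_def touching_Un by auto
  have "card (labels (I \<inter> J)) \<le> card (labels I \<inter> labels J)"
    by (rule card_mono) (use labels_Int in auto)
  then have "card (labels (I \<union> J)) + card (labels (I \<inter> J)) \<le> card (labels I) + card (labels J)"
    unfolding labels_Un using card_Un_Int[of "labels I" "labels J"] by simp
  moreover have "H I + 2 = 2 * card (labels I)" "H J + 2 = 2 * card (labels J)"
    using I J unfolding tight_def by auto
  ultimately have "H (I \<inter> J) + 2 = 2 * card (labels (I \<inter> J))"
    using hall[OF sub(1) ne'] hall[OF sub(2) ne] total_demand_Un_Int[of V d m I J] by linarith
  then show ?thesis using sub ne unfolding tight_def by simp
qed

text \<open>
  Adjoining a fixed label \<open>a\<close> makes the empty set satisfy the inequality with equality too, so that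
  families of such sets can be joined without assuming that they overlap.
\<close>

definition saturated :: "'b \<Rightarrow> (nat \<times> nat) set \<Rightarrow> bool" where
  "saturated a I \<longleftrightarrow> I \<subseteq> P \<and> H I + 2 = 2 * card (insert a (labels I))"

lemma hall_insert:
  assumes "I \<subseteq> P"
  shows "H I + 2 \<le> 2 * card (insert a (labels I))"
proof (cases "touching V d m I = {}")
  case True
  then have "H I = 0" using total_demand_eq_0_iff[OF finite_V] by blast
  then show ?thesis using True by simp
next
  case False
  then have "H I + 2 \<le> 2 * card (labels I)" using hall assms by blast
  also have "\<dots> \<le> 2 * card (insert a (labels I))" by (simp add: card_insert_le)
  finally show ?thesis .
qed

lemma saturated_Un:
  assumes I: "saturated a I" and J: "saturated a J"
  shows "saturated a (I \<union> J)"
proof -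
  let ?A = "\<lambda>I. insert a (labels I)"
  have sub: "I \<union> J \<subseteq> P" "I \<inter> J \<subseteq> P" using I J unfolding saturated_def by auto
  have Un: "?A (I \<union> J) = ?A I \<union> ?A J" unfolding labels_Un by auto
  have "?A (I \<inter> J) \<subseteq> ?A I \<inter> ?A J" using labels_Int[of I J] by blast
  then have "card (?A (I \<inter> J)) \<le> card (?A I \<inter> ?A J)"
    by (rule card_mono[rotated]) simp
  then have "card (?A (I \<union> J)) + card (?A (I \<inter> J)) \<le> card (?A I) + card (?A J)"
    unfolding Un using card_Un_Int[of "?A I" "?A J"] by simp
  moreover have "H I + 2 = 2 * card (?A I)" "H J + 2 = 2 * card (?A J)"
    using I J unfolding saturated_def by auto
  ultimately have "H (I \<union> J) + 2 = 2 * card (?A (I \<union> J))"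
    using hall_insert[OF sub(1), of a] hall_insert[OF sub(2), of a]
      total_demand_Un_Int[of V d m I J] by linarith
  then show ?thesis using sub unfolding saturated_def by simp
qed

lemma saturated_empty: "saturated a {}"
  by (simp add: saturated_def touching_def demand_def)

lemma tight_saturated: "tight I \<Longrightarrow> a \<in> labels I \<Longrightarrow> saturated a I"
  unfolding tight_def saturated_def by (simp add: insert_absorb)

text \<open>
  Let \<open>S\<close> be the union of all saturated sets without the type \<open>t\<close> of the half-edge \<open>j\<close>, and suppose that the
  labels of all possible partners lie in the set \<open>A\<close> of labels that \<open>S\<close> touches together with \<open>c v\<close>. Then \<open>t\<close>
  adds to \<open>A\<close> at most the labels of the vertices on the side of \<open>v\<close> other than \<open>v\<close> itself (none if both
  sides coincide), which are fewer than the edges of type \<open>t\<close>, so the inequality fails for \<open>S\<close> with \<open>t\<close> added.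
\<close>

lemma partner_exists:
  assumes v: "v \<in> V" and j: "j \<in># m v"
  obtains w where "w \<in> V" and "d w = j" and "d v \<in># m w"
    and "\<And>I. saturated (c v) I \<Longrightarrow> pair_type (d v) j \<notin> I \<Longrightarrow> c w \<notin> insert (c v) (labels I)"
proof -
  let ?t = "pair_type (d v) j"
  let ?F = "{I. saturated (c v) I \<and> ?t \<notin> I}"
  define S where "S = \<Union>?F"
  have "?F \<subseteq> Pow P" by (auto simp: saturated_def)
  then have "finite ?F" using finite_P finite_subset by blast
  then have "saturated (c v) (\<Union>G)" if "G \<subseteq> ?F" for G
    using that finite_subset[OF that \<open>finite ?F\<close>]
  proof (induction "G" rule: infinite_finite_induct)
    case empty
    then show ?case by (simp add: saturated_empty)
  next
    case (insert I G)
    then show ?case using saturated_Un[of "c v" I "\<Union>G"] by simp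
  qed simp
  from this[of ?F] have S: "saturated (c v) S" unfolding S_def by simp
  have tS: "?t \<notin> S" by (auto simp: S_def)
  let ?A = "insert (c v) (labels S)"
  let ?W = "{w \<in> V. d w = j \<and> d v \<in># m w}"
  let ?U = "{u \<in> V. d u = d v \<and> j \<in># m u}"
  have "\<exists>w\<in>?W. c w \<notin> ?A"
  proof (rule ccontr)
    assume "\<not> ?thesis"
    then have W: "c ` ?W \<subseteq> ?A" by auto
    have vU: "v \<in> ?U" using v j by simp
    have finU: "finite ?U" using finite_V by simp
    have touch: "touching V d m {?t} = ?U \<union> ?W"
      by (auto simp: touching_iff pair_type_eq_iff)
    have sub: "insert ?t S \<subseteq> P" using S types[OF v j] unfolding saturated_def by auto
    have HS: "H (insert ?t S) = H {?t} + H S"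
      using total_demand_Un_disjoint[of "{?t}" S V d m] tS by simp
    \<comment> \<open>The partners on the other side have labels in \<open>A\<close> by assumption, and so has \<open>v\<close>.\<close>
    have lab: "insert (c v) (labels (insert ?t S)) \<subseteq> ?A \<union> c ` (?U - {v})"
      using labels_Un[of "{?t}" S] W unfolding touch by auto
    have hall: "H (insert ?t S) + 2 \<le> 2 * card (insert (c v) (labels (insert ?t S)))"
      by (rule hall_insert[OF sub])
    have HSeq: "H S + 2 = 2 * card ?A" using S unfolding saturated_def by simp
    show False
    proof (cases "d v = j")
      case True
      then have "?U = ?W" by auto
      then have "insert (c v) (labels (insert ?t S)) \<subseteq> ?A"
        using labels_Un[of "{?t}" S] W unfolding touch by auto
      then have "card (insert (c v) (labels (insert ?t S))) \<le> card ?A"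
        by (rule card_mono[rotated]) simp
      moreover have "H {?t} \<noteq> 0"
        using total_demand_eq_0_iff[OF finite_V] touch vU by blast
      ultimately show False using hall HS HSeq by linarith
    next
      case False
      let ?e = "half_demand V d m (d v) j"
      have "card ?U = (\<Sum>u\<in>?U. 1)" by simp
      also have "\<dots> \<le> (\<Sum>u\<in>?U. count (m u) j)"
        by (rule sum_mono) (simp add: Suc_le_eq)
      also have "\<dots> \<le> ?e"
        unfolding half_demand_def by (rule sum_mono2) (use finite_V in auto)
      finally have "card ?U \<le> ?e" .
      moreover have "card (?U - {v}) + 1 = card ?U"
        using card_Suc_Diff1[OF finU vU] by simp
      moreover have "card (insert (c v) (labels (insert ?t S))) \<le> card (?A \<union> c ` (?U - {v}))"
        by (rule card_mono[OF _ lab]) (use finU in simp)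
      moreover have "card (?A \<union> c ` (?U - {v})) \<le> card ?A + card (c ` (?U - {v}))"
        by (rule card_Un_le)
      moreover have "card (c ` (?U - {v})) \<le> card (?U - {v})"
        by (rule card_image_le) (use finU in simp)
      moreover have "H {?t} = 2 * ?e"
        using False total_demand_pair_type[OF finite_V, of d m "d v" j] half_sym[of j "d v"] by simp
      ultimately show False using hall HS HSeq by linarith
    qed
  qed
  then obtain w where w: "w \<in> V" "d w = j" "d v \<in># m w" "c w \<notin> ?A" by blast
  have "c w \<notin> insert (c v) (labels I)" if "saturated (c v) I" "?t \<notin> I" for I
  proof -
    have "I \<subseteq> S" using that by (auto simp: S_def)
    then have "labels I \<subseteq> labels S" by (intro image_mono touching_mono)
    then show ?thesis using w(4) by blast
  qed
  then show thesis using that w by blast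
qed

text \<open>
  There are tight sets at all, because \<open>spanning\<close> makes \<open>P\<close> tight as long as some demand remains.
\<close>

lemma minimal_tight_exists:
  assumes "H P \<noteq> 0"
  obtains I where "tight I" and "\<And>J v. tight J \<Longrightarrow> v \<in> touching V d m (I \<inter> J) \<Longrightarrow> I \<subseteq> J"
proof -
  have "touching V d m P \<noteq> {}" using assms total_demand_eq_0_iff[OF finite_V, of d m P] by simp
  moreover have "card (labels P) \<le> card (c ` V)"
    by (intro card_mono image_mono touching_subset finite_imageI finite_V)
  ultimately have "tight P" using hall[of P] spanning unfolding tight_def by simp
  then obtain I where I: "tight I" and min: "\<And>J. tight J \<Longrightarrow> card I \<le> card J"
    using ex_has_least_nat[of tight P card] by blast
  have "I \<subseteq> J" if "tight J" "v \<in> touching V d m (I \<inter> J)" for J v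
  proof -
    have "card I \<le> card (I \<inter> J)" using tight_Int[OF I that(1)] that(2) by (intro min) auto
    moreover have "finite I" using I finite_P finite_subset unfolding tight_def by auto
    ultimately have "I \<inter> J = I" by (intro card_seteq) auto
    then show ?thesis by blast
  qed
  then show thesis using that I by blast
qed

text \<open>
  With \<open>k\<close> labels touched there are \<open>2 * k - 2\<close> half-edges. If each label has only one, then
  \<open>2 * k - 2 = k\<close>, so there are two labels and a single edge.
\<close>

lemma tight_branching_label:
  assumes "tight I"
  shows "H I = 2 \<or> (\<exists>v\<in>touching V d m I. 2 \<le> (\<Sum>u\<in>{u \<in> V. c u = c v}. demand d m I u))"
proof (rule ccontr)
  assume "\<not> ?thesis"
  then have H2: "H I \<noteq> 2"
    and small: "\<And>a. a \<in> labels I \<Longrightarrow> (\<Sum>u\<in>{u \<in> V. c u = a}. demand d m I u) \<le> 1"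
    by force+
  have "H I = (\<Sum>u\<in>touching V d m I. demand d m I u)"
    unfolding total_demand_def by (rule sum.mono_neutral_right) (use finite_V in \<open>auto simp: touching_def\<close>)
  also have "\<dots> = (\<Sum>a\<in>labels I. \<Sum>u\<in>{u \<in> touching V d m I. c u = a}. demand d m I u)"
    by (rule sum.image_gen) simp
  also have "\<dots> \<le> (\<Sum>a\<in>labels I. \<Sum>u\<in>{u \<in> V. c u = a}. demand d m I u)"
    by (intro sum_mono sum_mono2) (use finite_V in \<open>auto simp: touching_def\<close>)
  also have "\<dots> \<le> (\<Sum>a\<in>labels I. 1)" by (rule sum_mono) (rule small)
  finally have "H I \<le> card (labels I)" by simp
  moreover have "H I + 2 = 2 * card (labels I)" "H I \<noteq> 0"
    using assms total_demand_eq_0_iff[OF finite_V, of d m I] unfolding tight_def by auto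
  ultimately have "H I = 1" using H2 by linarith
  moreover have "even (H I)" using H_even assms unfolding tight_def by blast
  ultimately show False by (metis odd_one)
qed


lemma even_gap: "even h \<Longrightarrow> h + 2 \<le> 2 * k \<Longrightarrow> h + 2 \<noteq> 2 * k \<Longrightarrow> h + 4 \<le> 2 * k" for h k :: nat
  by presburger

lemma serve_edge:
  assumes v: "v \<in> V" "d w \<in># m v" and w: "w \<in> V" "d v \<in># m w" and neq: "v \<noteq> w"
  shows "count (m u) k = count (serve v w d m u) k + of_bool (u = v \<and> k = d w)
      + of_bool (u = w \<and> k = d v)"
    and "demand d m I u = demand d (serve v w d m) I u + of_bool (u = v \<and> pair_type (d v) (d w) \<in> I)
      + of_bool (u = w \<and> pair_type (d v) (d w) \<in> I)"
proof -
  obtain Mv Mw where mv: "m v = add_mset (d w) Mv" and mw: "m w = add_mset (d v) Mw"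
    using v(2) w(2) by (meson multi_member_split)
  show "count (m u) k = count (serve v w d m u) k + of_bool (u = v \<and> k = d w)
      + of_bool (u = w \<and> k = d v)"
    using neq mv mw by (cases "u = v"; cases "u = w") (auto simp: serve_def)
  show "demand d m I u = demand d (serve v w d m) I u
      + of_bool (u = v \<and> pair_type (d v) (d w) \<in> I) + of_bool (u = w \<and> pair_type (d v) (d w) \<in> I)"
    using neq mv mw pair_type_commute[of "d w" "d v"]
    by (cases "u = v"; cases "u = w") (auto simp: serve_def demand_def)
qed

lemma sum_of_bool_eq: "finite A \<Longrightarrow> (\<Sum>u\<in>A. of_bool (u = a \<and> Q)) = (of_bool (a \<in> A \<and> Q) :: nat)"
  by (cases Q) (auto simp: of_bool_def)

text \<open>
  In an equation about all vertices, the new edge counts once at each of its ends, hence twice in the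
  total for its type.
\<close>

lemma serve_edge_total:
  assumes v: "v \<in> V" "d w \<in># m v" and w: "w \<in> V" "d v \<in># m w" and neq: "v \<noteq> w"
  shows "half_demand V d m i k = half_demand V d (serve v w d m) i k
      + of_bool (i = d v \<and> k = d w) + of_bool (i = d w \<and> k = d v)"
    and "H I = total_demand V d (serve v w d m) I + 2 * of_bool (pair_type (d v) (d w) \<in> I)"
proof -
  let ?A = "{u \<in> V. d u = i}"
  have "half_demand V d m i k = half_demand V d (serve v w d m) i k
      + (\<Sum>u\<in>?A. of_bool (u = v \<and> k = d w)) + (\<Sum>u\<in>?A. of_bool (u = w \<and> k = d v))"
    by (simp only: half_demand_def serve_edge(1)[OF assms] sum.distrib)
  moreover have "finite ?A" using finite_V by simp
  ultimately have "half_demand V d m i k = half_demand V d (serve v w d m) i k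
      + of_bool (v \<in> ?A \<and> k = d w) + of_bool (w \<in> ?A \<and> k = d v)"
    by (simp only: sum_of_bool_eq)
  then show "half_demand V d m i k = half_demand V d (serve v w d m) i k
      + of_bool (i = d v \<and> k = d w) + of_bool (i = d w \<and> k = d v)"
    using v(1) w(1) by (simp only: mem_Collect_eq simp_thms eq_commute[of i])
  have "H I = total_demand V d (serve v w d m) I
      + (\<Sum>u\<in>V. of_bool (u = v \<and> pair_type (d v) (d w) \<in> I))
      + (\<Sum>u\<in>V. of_bool (u = w \<and> pair_type (d v) (d w) \<in> I))"
    by (simp only: total_demand_def serve_edge(2)[OF assms] sum.distrib)
  then show "H I = total_demand V d (serve v w d m) I + 2 * of_bool (pair_type (d v) (d w) \<in> I)"
    using v(1) w(1) by (simp only: sum_of_bool_eq[OF finite_V] simp_thms)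
qed

text \<open>
  The vertex \<open>v\<close> is taken at a label with two half-edges of a minimal tight set \<open>I\<close>, and \<open>w\<close> is a partner of
  \<open>v\<close>. The inequality for a set \<open>S\<close> without the new type is then kept by the choice of \<open>w\<close>, and for a tight \<open>S\<close>
  with the new type by the choice of \<open>v\<close>, as \<open>I \<subseteq> S\<close>. If \<open>I\<close> consists of a single edge, there is no such
  label, but then the new edge is the last one of its type.
\<close>

theorem edge_exists:
  assumes "H P \<noteq> 0"
  obtains v w where "v \<in> V" and "w \<in> V" and "d w \<in># m v" and "d v \<in># m w" and "c v \<noteq> c w"
    and "demand_system V d P (serve v w d m) (merge (c v) (c w) c)"
proof -
  obtain I where I: "tight I"
    and min: "\<And>J v. tight J \<Longrightarrow> v \<in> touching V d m (I \<inter> J) \<Longrightarrow> I \<subseteq> J"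
    using minimal_tight_exists[OF assms] by blast
  obtain v where vI: "v \<in> touching V d m I"
    and branching: "H I = 2 \<or> 2 \<le> (\<Sum>u\<in>{u \<in> V. c u = c v}. demand d m I u)"
    using tight_branching_label[OF I] I unfolding tight_def by blast
  then obtain j where v: "v \<in> V" and j: "j \<in># m v" "pair_type (d v) j \<in> I"
    by (auto simp: touching_iff)
  obtain w where w: "w \<in> V" "d w = j" "d v \<in># m w"
    and free: "\<And>S. saturated (c v) S \<Longrightarrow> pair_type (d v) j \<notin> S \<Longrightarrow> c w \<notin> insert (c v) (labels S)"
    using partner_exists[OF v j(1)] by blast
  let ?t = "pair_type (d v) (d w)" and ?m = "serve v w d m" and ?c = "merge (c v) (c w) c"
  note jw = w(2)[symmetric]
  have cvw: "c v \<noteq> c w" using free[OF saturated_empty] by auto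
  then have neq: "v \<noteq> w" by auto
  note edge = v j(1)[unfolded jw] w(1,3) neq
  note half = serve_edge_total(1)[OF edge] and total = serve_edge_total(2)[OF edge]
    and dem = serve_edge(2)[OF edge]
  let ?touch = "touching V d ?m"
  have touch_sub: "?touch S \<subseteq> touching V d m S" for S
    using dem by (fastforce simp: touching_def)
  have touch_other: "?touch S = touching V d m S" if "?t \<notin> S" for S
    using dem that by (auto simp: touching_def)
  have touch_unserved: "u \<in> ?touch S" if "u \<in> touching V d m S" "u \<noteq> v" "u \<noteq> w" for u S
    using dem that by (auto simp: touching_def)
  have vwS: "c v \<in> labels S" "c w \<in> labels S" if "?t \<in> S" for S
  proof -
    have "v \<in> touching V d m S" "w \<in> touching V d m S"
      using edge that pair_type_commute[of "d w" "d v"] unfolding touching_iff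
      by (metis)+
    then show "c v \<in> labels S" "c w \<in> labels S" by (auto intro: imageI)
  qed
  have "demand_system V d P ?m ?c"
  proof
    show "finite V" "finite P" by (fact finite_V finite_P)+
  next
    fix u k assume "u \<in> V" "k \<in># ?m u"
    then show "pair_type (d u) k \<in> P"
      using types[of u k] serve_edge(1)[OF edge, of u k] by (auto simp flip: count_greater_zero_iff)
  next
    fix i k show "half_demand V d ?m i k = half_demand V d ?m k i"
      using half[of i k] half[of k i] half_sym[of i k]
      by (simp only: conj_commute[of "k = d v"] conj_commute[of "k = d w"])
  next
    fix i show "even (half_demand V d ?m i i)"
      using half_even[of i] unfolding half[of i i] by (simp add: conj_commute) blast
  next
    have "?t \<in> P" using j(2) I jw unfolding tight_def by auto
    then have "H P = total_demand V d ?m P + 2" using total[of P] by simp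
    moreover have "card (?c ` V) = card (c ` V) - 1"
      using v w(1) by (intro card_merge_image_both finite_V cvw) simp_all
    ultimately show "total_demand V d ?m P + 2 = 2 * card (?c ` V)" using spanning by simp
  next
    fix S assume S: "S \<subseteq> P" and ne: "?touch S \<noteq> {}"
    show "total_demand V d ?m S + 2 \<le> 2 * card (?c ` ?touch S)"
    proof (cases "?t \<in> S")
      case False
      then have touch: "?touch S = touching V d m S" and HS: "H S = total_demand V d ?m S"
        using touch_other total[of S] by simp_all
      have le: "H S + 2 \<le> 2 * card (labels S)" using hall[OF S] ne touch by simp
      show ?thesis
      proof (cases "c v \<in> labels S \<and> c w \<in> labels S")
        case True
        then have "\<not> tight S" using tight_saturated free[of S] False jw by blast
        then have "H S + 2 \<noteq> 2 * card (labels S)" using S ne touch unfolding tight_def by auto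
        then have "H S + 4 \<le> 2 * card (labels S)" using le H_even[OF S] by (intro even_gap)
        moreover have "card (?c ` ?touch S) = card (labels S) - 1"
          unfolding touch using True by (intro card_merge_image_both finite_touching cvw) simp_all
        ultimately show ?thesis using HS by linarith
      next
        case False
        then have "card (?c ` ?touch S) = card (labels S)"
          unfolding touch by (rule card_merge_image_not_both)
        then show ?thesis using le HS by linarith
      qed
    next
      case True
      have HS: "H S = total_demand V d ?m S + 2" using total[of S] True by simp
      have le: "H S + 2 \<le> 2 * card (labels S)"
        using hall[OF S] touch_sub[of S] ne by auto
      have keep: "labels S - {c v, c w} \<subseteq> ?c ` ?touch S"
        using touch_unserved[of _ S] by (force simp: merge_def)
      have fin: "finite (?c ` ?touch S)" using finite_V by (simp add: touching_def)
      show ?thesis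
      proof (cases "\<exists>u\<in>?touch S. c u = c v \<or> c u = c w")
        case True
        then obtain u where u: "u \<in> ?touch S" "c u = c v \<or> c u = c w" by blast
        then have "?c u = c v" by (auto simp: merge_def)
        then have "c v \<in> ?c ` ?touch S" using u(1) by (metis imageI)
        then have "insert (c v) (labels S - {c v, c w}) \<subseteq> ?c ` ?touch S"
          using keep by (simp only: insert_subset)
        moreover have "L - {b} \<subseteq> insert a (L - {a, b})" for L and a b :: 'b by blast
        ultimately have "labels S - {c w} \<subseteq> ?c ` ?touch S" by (rule subset_trans[rotated])
        then have "card (labels S - {c w}) \<le> card (?c ` ?touch S)" by (rule card_mono[OF fin])
        then show ?thesis using le HS vwS(2)[OF \<open>?t \<in> S\<close>] by simp
      next
        case False
        \<comment> \<open>The merged label disappears. For a tight \<open>S\<close> this contradicts the choice of \<open>v\<close>, unless \<open>I\<close> is a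
            single edge, namely the new one.\<close>
        have nobranch: "H I = 2" if "tight S"
        proof (rule ccontr)
          assume "H I \<noteq> 2"
          then have two: "2 \<le> (\<Sum>u\<in>{u \<in> V. c u = c v}. demand d m I u)" using branching by simp
          have "v \<in> touching V d m (I \<inter> S)"
            using edge j \<open>?t \<in> S\<close> jw by (auto simp: touching_iff)
          then have "I \<subseteq> S" using min[OF that] by blast
          then have "(\<Sum>u\<in>{u \<in> V. c u = c v}. demand d m I u)
              \<le> (\<Sum>u\<in>{u \<in> V. c u = c v}. demand d m S u)"
            by (intro sum_mono demand_mono)
          also have "\<dots> = (\<Sum>u\<in>{u \<in> V. c u = c v}. of_bool (u = v))"
          proof (rule sum.cong)
            fix u assume u: "u \<in> {u \<in> V. c u = c v}"
            then have "demand d ?m S u = 0" using False by (auto simp: touching_def)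
            moreover have "u \<noteq> w" using u cvw by auto
            ultimately show "demand d m S u = of_bool (u = v)" using dem[of S u] \<open>?t \<in> S\<close> by simp
          qed simp
          also have "\<dots> \<le> 1" using finite_V sum_of_bool_eq[of "{u \<in> V. c u = c v}" v True] by simp
          finally show False using two by simp
        qed
        show ?thesis
        proof (cases "tight S")
          case False
          then have "H S + 2 \<noteq> 2 * card (labels S)"
            using S ne touch_sub[of S] unfolding tight_def by auto
          then have "H S + 4 \<le> 2 * card (labels S)" using le H_even[OF S] by (intro even_gap)
          moreover have "card (labels S) \<le> card (labels S - {c v, c w}) + 2"
            using card_Diff_subset[of "{c v, c w}" "labels S"] vwS[OF \<open>?t \<in> S\<close>] cvw
            by (simp add: card_Diff_insert)
          moreover have "card (labels S - {c v, c w}) \<le> card (?c ` ?touch S)"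
            by (rule card_mono[OF fin keep])
          ultimately show ?thesis using HS by linarith
        next
          case True
          \<comment> \<open>The new edge was the last one of its type, so the inequality for \<open>S\<close> is the old one for
              \<open>S\<close> without this type, whose labels are not affected by the merge.\<close>
          have "total_demand V d ?m I = 0"
            using total[of I] nobranch[OF True] j(2) jw by simp
          then have "total_demand V d ?m {?t} = 0"
            using j(2) jw finite_V touching_mono[of "{?t}" I V d ?m]
            by (auto simp: total_demand_eq_0_iff)
          then have served: "total_demand V d ?m {?t} = 0" "?touch {?t} = {}"
            using finite_V by (auto simp: total_demand_eq_0_iff)
          have S_eq: "S = {?t} \<union> (S - {?t})" using \<open>?t \<in> S\<close> by blast
          have touch: "?touch S = touching V d m (S - {?t})"
            using touching_Un[of V d ?m "{?t}" "S - {?t}"] S_eq served touch_other[of "S - {?t}"] by simp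
          have "total_demand V d ?m S = total_demand V d ?m (S - {?t})"
            using total_demand_Un_disjoint[of "{?t}" "S - {?t}" V d ?m] S_eq served by simp
          also have "\<dots> = H (S - {?t})" using total[of "S - {?t}"] by simp
          finally have "total_demand V d ?m S + 2 \<le> 2 * card (labels (S - {?t}))"
            using hall[of "S - {?t}"] S ne touch by auto
          moreover have "?c ` ?touch S = c ` ?touch S"
            using False by (intro image_cong) (auto simp: merge_def)
          ultimately show ?thesis unfolding touch by simp
        qed
      qed
    qed
  qed
  then show thesis using that edge cvw by blast
qed

end

section \<open>Building a connected graph that meets the demands\<close>

definition nbr_degrees :: "('a \<Rightarrow> nat) \<Rightarrow> 'a set set \<Rightarrow> 'a \<Rightarrow> nat multiset" where
  "nbr_degrees d E v = image_mset d (mset_set (nbrs E v))"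

lemma size_nbr_degrees: "size (nbr_degrees d E v) = deg E v"
  by (simp add: nbr_degrees_def deg_def)

lemma size_filter_nbr_degrees:
  assumes "finite (nbrs E v)"
  shows "size {#j \<in># nbr_degrees d E v. Q j#} = card {w \<in> nbrs E v. Q (d w)}"
  using assms by (simp add: nbr_degrees_def filter_mset_image_mset)

lemma nbr_degrees_insert_edge:
  assumes "simple_graph V E" and "{v, w} \<notin> E" and "v \<noteq> w"
  shows "nbr_degrees d (insert {v, w} E) u =
    nbr_degrees d E u + (if u = v then {#d w#} else {#}) + (if u = w then {#d v#} else {#})"
proof -
  have fin: "finite (nbrs E u)" by (rule finite_nbrs[OF assms(1)])
  consider "u = v" | "u = w" "u \<noteq> v" | "u \<noteq> v" "u \<noteq> w" by blast
  then show ?thesis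
  proof cases
    case 1
    then have "nbrs (insert {v, w} E) u = insert w (nbrs E u)" "w \<notin> nbrs E u"
      using assms by (auto simp: nbrs_def doubleton_eq_iff)
    then show ?thesis using 1 assms(3) fin by (simp add: nbr_degrees_def)
  next
    case 2
    then have "nbrs (insert {v, w} E) u = insert v (nbrs E u)" "v \<notin> nbrs E u"
      using assms by (auto simp: nbrs_def doubleton_eq_iff insert_commute)
    then show ?thesis using 2 fin by (simp add: nbr_degrees_def)
  next
    case 3
    then have "nbrs (insert {v, w} E) u = nbrs E u"
      by (auto simp: nbrs_def doubleton_eq_iff)
    then show ?thesis using 3 by (simp add: nbr_degrees_def)
  qed
qed

lemma rtrancl_merge:
  assumes conn: "\<And>u x. u \<in> V \<Longrightarrow> x \<in> V \<Longrightarrow> c u = c x \<Longrightarrow> (u, x) \<in> {(a, b). {a, b} \<in> E}\<^sup>*"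
    and vw: "v \<in> V" "w \<in> V" and ux: "u \<in> V" "x \<in> V"
    and eq: "merge (c v) (c w) c u = merge (c v) (c w) c x"
  shows "(u, x) \<in> {(a, b). {a, b} \<in> insert {v, w} E}\<^sup>*"
proof -
  let ?R = "{(a, b). {a, b} \<in> insert {v, w} E}"
  have "{(a, b). {a, b} \<in> E} \<subseteq> ?R" by auto
  then have mono: "(a, b) \<in> ?R\<^sup>*" if "a \<in> V" "b \<in> V" "c a = c b" for a b
    using conn[OF that] rtrancl_mono by blast
  have new: "(v, w) \<in> ?R\<^sup>*" "(w, v) \<in> ?R\<^sup>*" by (auto simp: insert_commute)
  consider "c u = c x" | "c u = c v" "c x = c w" | "c u = c w" "c x = c v"
    using eq unfolding merge_def by (metis (full_types))
  then show ?thesis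
  proof cases
    case 1
    then show ?thesis by (rule mono[OF ux])
  next
    case 2
    have "(u, v) \<in> ?R\<^sup>*" by (rule mono[OF ux(1) vw(1) 2(1)])
    also note new(1)
    also have "(w, x) \<in> ?R\<^sup>*" by (rule mono[OF vw(2) ux(2) 2(2)[symmetric]])
    finally show ?thesis .
  next
    case 3
    have "(u, w) \<in> ?R\<^sup>*" by (rule mono[OF ux(1) vw(2) 3(1)])
    also note new(2)
    also have "(v, x) \<in> ?R\<^sup>*" by (rule mono[OF vw(1) ux(2) 3(2)[symmetric]])
    finally show ?thesis .
  qed
qed

text \<open>
  Each step of \<open>edge_exists\<close> reduces the total demand by two. In the end \<open>spanning\<close> leaves a single
  label, and vertices with equal labels are connected.
\<close>

theorem realization_exists:
  assumes "demand_system V d P m c" and "simple_graph V E"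
    and "\<And>u w. {u, w} \<in> E \<Longrightarrow> c u = c w"
    and "\<And>u w. u \<in> V \<Longrightarrow> w \<in> V \<Longrightarrow> c u = c w \<Longrightarrow> (u, w) \<in> {(a, b). {a, b} \<in> E}\<^sup>*"
  shows "\<exists>E'. simple_graph V E' \<and> connected_graph V E' \<and>
    2 * card E' = 2 * card E + total_demand V d m P \<and>
    (\<forall>v\<in>V. nbr_degrees d E' v = nbr_degrees d E v + m v)"
  using assms
proof (induction "total_demand V d m P" arbitrary: m c E rule: less_induct)
  case less
  interpret demand_system V d P m c by (rule less.prems(1))
  note simple = less.prems(2) and same = less.prems(3) and conn = less.prems(4)
  show ?case
  proof (cases "total_demand V d m P = 0")
    case True
    then have "touching V d m P = {}" using total_demand_eq_0_iff[OF finite_V] by metis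
    then have empty: "m v = {#}" if "v \<in> V" for v
      using types[OF that] that touching_iff[of v V d m P] by (cases "m v") auto
    have "card (c ` V) = 1" using spanning True by simp
    then obtain a where "c ` V = {a}" by (rule card_1_singletonE)
    then have "c u = a" if "u \<in> V" for u using that by blast
    then have "connected_graph V E"
      using conn \<open>c ` V = {a}\<close> unfolding connected_graph_def by auto
    then show ?thesis using simple True empty by (intro exI[of _ E]) simp
  next
    case False
    then obtain v w where vw: "v \<in> V" "w \<in> V" "d w \<in># m v" "d v \<in># m w" "c v \<noteq> c w"
      and sys: "demand_system V d P (serve v w d m) (merge (c v) (c w) c)"
      using edge_exists by blast
    let ?m = "serve v w d m" and ?c = "merge (c v) (c w) c" and ?E = "insert {v, w} E"
    have neq: "v \<noteq> w" using vw(5) by auto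
    have new: "{v, w} \<notin> E" using same vw(5) by blast
    have simple': "simple_graph V ?E"
      using simple vw(1,2) neq unfolding simple_graph_def by auto
    have total: "total_demand V d m P = total_demand V d ?m P + 2"
      using serve_edge_total(2)[OF vw(1,3,2,4) neq, of P] types[OF vw(1,3)] by simp
    have "\<exists>E'. simple_graph V E' \<and> connected_graph V E' \<and>
      2 * card E' = 2 * card ?E + total_demand V d ?m P \<and>
      (\<forall>u\<in>V. nbr_degrees d E' u = nbr_degrees d ?E u + ?m u)"
    proof (rule less.hyps)
      show "total_demand V d ?m P < total_demand V d m P" using total by simp
      show "demand_system V d P ?m ?c" by (rule sys)
      show "simple_graph V ?E" by (rule simple')
      show "?c a = ?c b" if "{a, b} \<in> ?E" for a b
        using that same[of a b] by (auto simp: doubleton_eq_iff merge_def)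
      show "(a, b) \<in> {(a, b). {a, b} \<in> ?E}\<^sup>*" if "a \<in> V" "b \<in> V" "?c a = ?c b" for a b
        using rtrancl_merge[OF conn vw(1,2) that] .
    qed
    then obtain E' where E': "simple_graph V E'" "connected_graph V E'"
      "2 * card E' = 2 * card ?E + total_demand V d ?m P"
      "\<And>u. u \<in> V \<Longrightarrow> nbr_degrees d E' u = nbr_degrees d ?E u + ?m u" by blast
    obtain Mv Mw where M: "m v = add_mset (d w) Mv" "m w = add_mset (d v) Mw"
      using vw(3,4) by (meson multi_member_split)
    have same_degrees: "nbr_degrees d ?E u + ?m u = nbr_degrees d E u + m u" for u
      unfolding nbr_degrees_insert_edge[OF simple new neq]
      using neq M by (cases "u = v"; cases "u = w") (simp_all add: serve_def)
    have "card ?E = card E + 1"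
      using new simple_graph_finite_edges[OF simple] by simp
    then have "2 * card E' = 2 * card E + total_demand V d m P"
      using E'(3) total by linarith
    then show ?thesis using E'(1,2,4) same_degrees by metis
  qed
qed

section \<open>Solutions as profiles of neighbour degrees\<close>

lemma finite_parts_le: "finite (parts_le \<Delta>)"
proof (rule finite_subset)
  show "parts_le \<Delta> \<subseteq> mset ` {xs. set xs \<subseteq> {..\<Delta>} \<and> length xs \<le> \<Delta>}"
  proof
    fix l assume l: "l \<in> parts_le \<Delta>"
    obtain xs where "mset xs = l" using ex_mset by blast
    then show "l \<in> mset ` {xs. set xs \<subseteq> {..\<Delta>} \<and> length xs \<le> \<Delta>}"
      using l unfolding parts_le_def by (intro image_eqI[of _ _ xs]) auto
  qed
  show "finite (mset ` {xs. set xs \<subseteq> {..\<Delta>} \<and> length xs \<le> \<Delta>})"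
    by (intro finite_imageI finite_lists_length_le) simp
qed

lemma finite_pair_types: "finite (pair_types \<Delta>)"
  by (rule finite_subset[of _ "{..\<Delta>} \<times> {..\<Delta>}"]) (auto simp: pair_types_def)

text \<open>
  The pairs in \<open>I\<close> have the smaller degree first, so that \<open>touched\<close>, which looks for the pair in either order, asks
  for the type of the half-edge.
\<close>

lemma touched_eq:
  assumes I: "I \<subseteq> pair_types \<Delta>"
  shows "touched I l = of_bool (\<exists>j\<in>#l. pair_type (size l) j \<in> I)"
proof -
  let ?J = "{j. (size l, j) \<in> I \<or> (j, size l) \<in> I}"
  have J: "?J = {j. pair_type (size l) j \<in> I}"
    using I by (auto simp: pair_type_def pair_types_def min_def max_def)
  have "?J \<subseteq> {..\<Delta>}" using I by (auto simp: pair_types_def)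
  then have fin: "finite ?J" by (rule finite_subset) simp
  show ?thesis
  proof (cases "\<exists>j\<in>#l. pair_type (size l) j \<in> I")
    case True
    then obtain j where j: "j \<in># l" "j \<in> ?J" unfolding J by blast
    then have "0 < count l j" by simp
    also have "\<dots> \<le> (\<Sum>j\<in>?J. count l j)" using j fin by (intro member_le_sum) auto
    finally have "0 < (\<Sum>j\<in>?J. count l j)" .
    then have "1 \<le> (\<Sum>j\<in>?J. int (count l j))" by (simp flip: of_nat_sum)
    then show ?thesis using True unfolding touched_def by (simp add: min_def)
  next
    case False
    then have "(\<Sum>j\<in>?J. int (count l j)) = 0"
      unfolding J by (intro sum.neutral) (auto simp: not_in_iff)
    then show ?thesis using False unfolding touched_def by simp
  qed
qed

text \<open>
  Distributing the multisets over the vertices turns the sums over partitions in the integer program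
  into sums over vertices.
\<close>

locale neighbour_profile =
  fixes V :: "'a set" and d :: "'a \<Rightarrow> nat" and L :: "'a \<Rightarrow> nat multiset"
    and \<Delta> :: nat and x :: "nat multiset \<Rightarrow> int"
  assumes finite_V: "finite V"
    and in_parts: "\<And>v. v \<in> V \<Longrightarrow> L v \<in> parts_le \<Delta>"
    and size_L: "\<And>v. v \<in> V \<Longrightarrow> size (L v) = d v"
    and fibres: "\<And>l. l \<in> parts_le \<Delta> \<Longrightarrow> x l = int (card {v \<in> V. L v = l})"
begin

lemma sum_over_vertices: "(\<Sum>l\<in>parts_le \<Delta>. x l * g l) = (\<Sum>v\<in>V. g (L v))"
proof -
  have "(\<Sum>v\<in>V. g (L v)) = (\<Sum>l\<in>parts_le \<Delta>. \<Sum>v\<in>{v \<in> V. L v = l}. g (L v))"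
    by (rule sum.group[symmetric]) (use finite_V finite_parts_le in_parts in auto)
  also have "\<dots> = (\<Sum>l\<in>parts_le \<Delta>. x l * g l)"
    by (intro sum.cong refl) (simp add: fibres)
  finally show ?thesis by simp
qed

lemma half_edges_eq: "half_edges \<Delta> x i j = int (half_demand V d L i j)"
proof -
  have "half_edges \<Delta> x i j =
      (\<Sum>l\<in>parts_le \<Delta>. x l * (if size l = i then int (count l j) else 0))"
    unfolding half_edges_def sum.inter_filter[OF finite_parts_le] by (intro sum.cong) auto
  also have "\<dots> = (\<Sum>v\<in>V. if d v = i then int (count (L v) j) else 0)"
    unfolding sum_over_vertices by (intro sum.cong) (auto simp: size_L)
  also have "\<dots> = int (half_demand V d L i j)"
    unfolding half_demand_def sum.inter_filter[OF finite_V] of_nat_sum by (intro sum.cong) auto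
  finally show ?thesis .
qed

lemma incident_eq:
  assumes "I \<subseteq> pair_types \<Delta>"
  shows "incident \<Delta> x I = int (card (touching V d L I))"
proof -
  have "incident \<Delta> x I = (\<Sum>v\<in>V. of_bool (\<exists>j\<in>#L v. pair_type (size (L v)) j \<in> I))"
    unfolding incident_def touched_eq[OF assms] sum_over_vertices ..
  also have "\<dots> = (\<Sum>v\<in>V. of_bool (v \<in> touching V d L I))"
    by (intro sum.cong refl) (simp add: touching_iff size_L)
  also have "\<dots> = int (card (touching V d L I))"
    using finite_V touching_subset[of V d L I] by (simp add: of_bool_def sum.If_cases Int_absorb1)
  finally show ?thesis .
qed

lemma subset_ineq_iff:
  assumes I: "I \<subseteq> pair_types \<Delta>"
  shows "subset_ineq \<Delta> x I \<longleftrightarrow> total_demand V d L I + 2 \<le> 2 * card (touching V d L I)"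
proof -
  let ?off = "{(i, j) \<in> I. i \<noteq> j}" and ?diag = "{i. (i, i) \<in> I}"
  let ?T = "\<lambda>t. total_demand V d L {t}"
  have fin: "finite I" using I finite_pair_types finite_subset by blast
  have fins: "finite ?off" "finite ((\<lambda>i. (i, i)) ` ?diag)"
    by (rule finite_subset[OF _ fin]; auto)+
  have le: "i \<le> j" if "(i, j) \<in> I" for i j using that I by (auto simp: pair_types_def)
  have T: "?T (i, j) = half_demand V d L i j + (if i \<noteq> j then half_demand V d L j i else 0)"
    if "(i, j) \<in> I" for i j
    using total_demand_pair_type[OF finite_V, of d L i j] le[OF that] by (simp add: pair_type_def)
  have "I = ?off \<union> (\<lambda>i. (i, i)) ` ?diag" by auto
  then have "total_demand V d L I = sum ?T (?off \<union> (\<lambda>i. (i, i)) ` ?diag)"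
    using total_demand_sum[OF fin, of V d L] by simp
  also have "\<dots> = sum ?T ?off + sum ?T ((\<lambda>i. (i, i)) ` ?diag)"
    by (rule sum.union_disjoint[OF fins]) auto
  also have "sum ?T ((\<lambda>i. (i, i)) ` ?diag) = (\<Sum>i\<in>?diag. half_demand V d L i i)"
    by (subst sum.reindex) (auto simp: inj_on_def T intro!: sum.cong)
  also have "sum ?T ?off = (\<Sum>(i, j)\<in>?off. half_demand V d L i j + half_demand V d L j i)"
    by (intro sum.cong) (auto simp: T)
  finally have "int (total_demand V d L I) =
      (\<Sum>(i, j)\<in>?off. half_edges \<Delta> x i j + half_edges \<Delta> x j i) + (\<Sum>i\<in>?diag. half_edges \<Delta> x i i)"
    by (simp add: half_edges_eq case_prod_unfold)
  then show ?thesis unfolding subset_ineq_def incident_eq[OF I] by linarith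
qed

end

text \<open>
  By induction on \<open>L\<close>, each \<open>l\<close> can be given any \<open>x l\<close> of the elements of \<open>A\<close> that are left.
\<close>

lemma function_with_fibres:
  assumes "finite L" and "finite A" and "sum x L = card A"
  shows "\<exists>f. (\<forall>a\<in>A. f a \<in> L) \<and> (\<forall>l\<in>L. card {a \<in> A. f a = l} = x l)"
  using assms
proof (induction L arbitrary: A rule: finite_induct)
  case empty
  then show ?case by simp
next
  case (insert l L)
  then have "x l \<le> card A" by simp
  then obtain B where B: "B \<subseteq> A" "card B = x l" "finite B"
    by (rule obtain_subset_with_card_n)
  have "sum x L = card (A - B)" using insert B by (simp add: card_Diff_subset)
  then obtain f where f: "\<forall>a\<in>A - B. f a \<in> L" "\<forall>k\<in>L. card {a \<in> A - B. f a = k} = x k"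
    using insert.IH[of "A - B"] insert.prems(1) by auto
  let ?f = "\<lambda>a. if a \<in> B then l else f a"
  have "{a \<in> A. ?f a = l} = B" using f(1) insert.hyps(2) B(1) by auto
  moreover have "{a \<in> A. ?f a = k} = {a \<in> A - B. f a = k}" if "k \<in> L" for k
    using that insert.hyps(2) by auto
  ultimately show ?case using f B by (intro exI[of _ ?f]) simp
qed

section \<open>From a solution to a tree\<close>

text \<open>
  The vertices with degree \<open>d\<close> and neighbour degree sum \<open>f\<close> are as many as the multisets that \<open>x\<close> provides
  for them, so each such class of vertices can be treated on its own.
\<close>

lemma ip_solution_profile:
  assumes sol: "ip_solution D F x p"
  obtains L where "neighbour_profile {..<length D} ((!) D) L (Max (set D)) x"
    and "\<And>v. v < length D \<Longrightarrow> sum_mset (L v) = F ! v"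
proof -
  let ?\<Delta> = "Max (set D)" and ?V = "{..<length D}"
  let ?P = "\<lambda>d f. {l \<in> parts_le ?\<Delta>. partition_of l f \<and> size l = d}"
  let ?A = "\<lambda>d f. {v \<in> ?V. D ! v = d \<and> F ! v = f}"
  have eq: "(\<Sum>l\<in>?P d f. x l) = int (y_count D F d f)" for d f
    using conjunct1[OF sol[unfolded ip_solution_def Let_def]] by (elim allE)
  have nonneg: "0 \<le> x l" if "l \<in> parts_le ?\<Delta>" for l
    using conjunct1[OF conjunct2[OF sol[unfolded ip_solution_def Let_def]]] that by (elim bspec)
  define Q where "Q d f g \<longleftrightarrow> (\<forall>v\<in>?A d f. g v \<in> ?P d f) \<and>
      (\<forall>l\<in>?P d f. card {v \<in> ?A d f. g v = l} = nat (x l))" for d f g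
  have "\<exists>g. Q d f g" for d f
    unfolding Q_def
  proof (rule function_with_fibres)
    show "finite (?P d f)" using finite_parts_le by simp
    have "int (\<Sum>l\<in>?P d f. nat (x l)) = (\<Sum>l\<in>?P d f. x l)"
      unfolding of_nat_sum by (intro sum.cong) (auto simp: nonneg)
    also have "\<dots> = int (card (?A d f))" unfolding eq y_count_def by simp
    finally show "(\<Sum>l\<in>?P d f. nat (x l)) = card (?A d f)" by (simp only: of_nat_eq_iff)
  qed simp
  then obtain g where Q: "\<And>d f. Q d f (g d f)" by metis
  note g = bspec[OF conjunct1[OF Q[unfolded Q_def]]] bspec[OF conjunct2[OF Q[unfolded Q_def]]]
  define L where "L v = g (D ! v) (F ! v) v" for v
  have L: "L v \<in> ?P (D ! v) (F ! v)" if "v \<in> ?V" for v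
    using that unfolding L_def by (intro g(1)) simp
  have "neighbour_profile ?V ((!) D) L ?\<Delta> x"
  proof
    show "finite ?V" by simp
  next
    fix v assume "v \<in> ?V"
    then show "L v \<in> parts_le ?\<Delta>" "size (L v) = D ! v" using L by auto
  next
    fix l assume l: "l \<in> parts_le ?\<Delta>"
    then have lP: "l \<in> ?P (size l) (sum_mset l)" by (auto simp: parts_le_def partition_of_def)
    have "{v \<in> ?V. L v = l} = {v \<in> ?A (size l) (sum_mset l). g (size l) (sum_mset l) v = l}"
    proof (intro set_eqI iffI)
      fix v assume v: "v \<in> {v \<in> ?V. L v = l}"
      then have "size l = D ! v" "sum_mset l = F ! v" using L[of v] by (auto simp: partition_of_def)
      then show "v \<in> {v \<in> ?A (size l) (sum_mset l). g (size l) (sum_mset l) v = l}"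
        using v by (simp add: L_def)
    qed (auto simp: L_def)
    then show "x l = int (card {v \<in> ?V. L v = l})" using g(2)[OF lP] nonneg[OF l] by simp
  qed
  moreover have "sum_mset (L v) = F ! v" if "v < length D" for v
    using L[of v] that by (simp add: partition_of_def)
  ultimately show thesis by (rule that)
qed

text \<open>
  Every multiset that occurs in the tree comes from the profile, so that \<open>x\<close> does not vanish there. This is
  what the caterpillar condition is applied to.
\<close>

lemma ip_solution_imp_tree:
  assumes nonempty: "D \<noteq> []" and pos: "\<forall>d\<in>set D. 0 < d"
    and degree_sum: "tree_degree_sum D" and sol: "ip_solution D F x p"
  obtains E where "is_tree {..<length D} E" and "realizes E D F"
    and "\<And>v. v < length D \<Longrightarrow> nbr_degrees ((!) D) E v \<in> parts_le (Max (set D))"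
    and "\<And>v. v < length D \<Longrightarrow> x (nbr_degrees ((!) D) E v) \<noteq> 0"
proof -
  let ?\<Delta> = "Max (set D)" and ?V = "{..<length D}" and ?d = "(!) D"
  obtain L where "neighbour_profile ?V ?d L ?\<Delta> x"
    and sumL: "\<And>v. v < length D \<Longrightarrow> sum_mset (L v) = F ! v"
    using ip_solution_profile[OF sol] by blast
  then interpret neighbour_profile ?V ?d L ?\<Delta> x by simp
  let ?h = "half_demand ?V ?d L"
  have bounds: "1 \<le> ?d v" "?d v \<le> ?\<Delta>" if "v \<in> ?V" for v
    using that pos nth_mem[of v D] by (auto simp: Suc_le_eq)
  have partL: "1 \<le> j" "j \<le> ?\<Delta>" if "v \<in> ?V" "j \<in># L v" for v j
  proof -
    show "1 \<le> j" using in_parts[OF that(1)] that(2) unfolding parts_le_def partition_of_def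
      by (cases j) auto
    show "j \<le> ?\<Delta>" using in_parts[OF that(1)] that(2) unfolding parts_le_def by blast
  qed
  have outside: "?h i j = 0" "?h j i = 0" if "\<not> (1 \<le> i \<and> i \<le> ?\<Delta>)" for i j
  proof -
    show "?h i j = 0" unfolding half_demand_def using that bounds by (intro sum.neutral) auto
    show "?h j i = 0" unfolding half_demand_def using that partL
      by (intro sum.neutral ballI) (metis count_eq_zero_iff mem_Collect_eq)
  qed
  have sym_less: "?h i j = ?h j i" if "1 \<le> i" "i < j" "j \<le> ?\<Delta>" for i j
    using sol that unfolding ip_solution_def Let_def half_edges_eq of_nat_eq_iff by blast
  have "demand_system ?V ?d (pair_types ?\<Delta>) L id"
  proof
    show "finite ?V" by simp
    show "finite (pair_types ?\<Delta>)" by (rule finite_pair_types)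
  next
    fix v j assume "v \<in> ?V" "j \<in># L v"
    then show "pair_type (?d v) j \<in> pair_types ?\<Delta>"
      using bounds[of v] partL[of v j] by (auto simp: pair_type_def pair_types_def min_def max_def)
  next
    fix i j
    consider "\<not> (1 \<le> i \<and> i \<le> ?\<Delta>)" | "\<not> (1 \<le> j \<and> j \<le> ?\<Delta>)" | "1 \<le> i" "i < j" "j \<le> ?\<Delta>"
      | "1 \<le> j" "j < i" "i \<le> ?\<Delta>" | "i = j" by linarith
    then show "?h i j = ?h j i"
    proof cases
      case 1 then show ?thesis by (simp only: outside[OF 1])
    next
      case 2 then show ?thesis by (simp only: outside[OF 2])
    next
      case 3 then show ?thesis by (rule sym_less)
    next
      case 4 then show ?thesis by (rule sym_less[symmetric])
    qed simp
  next
    fix i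
    show "even (?h i i)"
    proof (cases "1 \<le> i \<and> i \<le> ?\<Delta>")
      case True
      then have "int (?h i i) = 2 * p i"
        using sol unfolding ip_solution_def Let_def half_edges_eq by blast
      then show ?thesis by presburger
    next
      case False
      then show ?thesis by (simp only: outside[OF False] even_zero)
    qed
  next
    fix I assume I: "I \<subseteq> pair_types ?\<Delta>" and ne: "touching ?V ?d L I \<noteq> {}"
    have "finite (touching ?V ?d L I)" by (simp add: touching_def)
    then have "incident ?\<Delta> x I \<noteq> 0" using ne unfolding incident_eq[OF I] by simp
    then have "subset_ineq ?\<Delta> x I" using sol I unfolding ip_solution_def Let_def by blast
    then show "total_demand ?V ?d L I + 2 \<le> 2 * card (id ` touching ?V ?d L I)"
      unfolding subset_ineq_iff[OF I] by simp
  next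
    have "{#j \<in># L v. pair_type (?d v) j \<in> pair_types ?\<Delta>#} = L v" if "v \<in> ?V" for v
      using bounds[OF that] partL[OF that]
      by (auto simp: pair_type_def pair_types_def filter_mset_eq_conv min_def max_def)
    then have "total_demand ?V ?d L (pair_types ?\<Delta>) = (\<Sum>v\<in>?V. D ! v)"
      unfolding total_demand_def demand_def by (intro sum.cong) (simp_all add: size_L)
    also have "\<dots> = sum_list D" by (simp add: sum_list_sum_nth atLeast0LessThan)
    finally show "total_demand ?V ?d L (pair_types ?\<Delta>) + 2 = 2 * card (id ` ?V)"
      using degree_sum nonempty unfolding tree_degree_sum_def by simp
  qed
  then interpret dsys: demand_system ?V ?d "pair_types ?\<Delta>" L id .
  have "\<exists>E. simple_graph ?V E \<and> connected_graph ?V E \<and>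
      2 * card E = 2 * card ({} :: nat set set) + total_demand ?V ?d L (pair_types ?\<Delta>) \<and>
      (\<forall>v\<in>?V. nbr_degrees ?d E v = nbr_degrees ?d {} v + L v)"
    by (rule realization_exists[OF dsys.demand_system_axioms]) (auto simp: simple_graph_def)
  then obtain E where simple: "simple_graph ?V E" and conn: "connected_graph ?V E"
    and "2 * card E + 2 = 2 * length D"
    and "\<And>v. v \<in> ?V \<Longrightarrow> nbr_degrees ?d E v = nbr_degrees ?d {} v + L v"
    using dsys.spanning by auto
  then have few: "card E + 1 \<le> card ?V" and EL: "\<And>v. v \<in> ?V \<Longrightarrow> nbr_degrees ?d E v = L v"
    by (simp_all add: nbr_degrees_def nbrs_def)
  have tree: "is_tree ?V E"
    unfolding is_tree_def using simple conn connected_few_edges_acyclic[OF simple conn few] by blast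
  have deg: "deg E v = D ! v" if "v \<in> ?V" for v
    using EL[OF that] size_L[OF that] size_nbr_degrees[of ?d E v] by simp
  have "realizes E D F"
    unfolding realizes_def
  proof (intro allI impI conjI)
    fix v assume v: "v < length D"
    show "deg E v = D ! v" using deg v by simp
    have "(\<Sum>w\<in>nbrs E v. deg E w) = (\<Sum>w\<in>nbrs E v. D ! w)"
      using deg nbrs_subset[OF simple, of v] by (intro sum.cong) auto
    also have "\<dots> = sum_mset (nbr_degrees ?d E v)"
      unfolding nbr_degrees_def by (simp add: sum_unfold_sum_mset)
    finally show "(\<Sum>w\<in>nbrs E v. deg E w) = F ! v" using EL sumL v by simp
  qed
  moreover have "nbr_degrees ?d E v \<in> parts_le ?\<Delta>" "x (nbr_degrees ?d E v) \<noteq> 0"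
    if "v < length D" for v
  proof -
    show *: "nbr_degrees ?d E v \<in> parts_le ?\<Delta>" using EL in_parts that by simp
    have "v \<in> {u \<in> ?V. L u = nbr_degrees ?d E v}" using EL that by simp
    then have "card {u \<in> ?V. L u = nbr_degrees ?d E v} \<noteq> 0" by (auto simp: card_eq_0_iff)
    then show "x (nbr_degrees ?d E v) \<noteq> 0" using fibres[OF *] by simp
  qed
  ultimately show thesis using that tree by blast
qed

text \<open>
  The parts greater than one of the multiset at \<open>v\<close> are the non-leaf neighbours of \<open>v\<close>.
\<close>

lemma caterpillar_support_imp_caterpillar:
  assumes pos: "\<forall>d\<in>set D. 0 < d" and supp: "caterpillar_support D x"
    and tree: "is_tree {..<length D} E" and real: "realizes E D F"
    and parts: "\<And>v. v < length D \<Longrightarrow> nbr_degrees ((!) D) E v \<in> parts_le (Max (set D))"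
    and used: "\<And>v. v < length D \<Longrightarrow> x (nbr_degrees ((!) D) E v) \<noteq> 0"
  shows "is_caterpillar {..<length D} E"
proof (rule caterpillarI[OF tree])
  fix v assume v: "v \<in> {..<length D}" and "deg E v \<noteq> 1"
  let ?l = "nbr_degrees ((!) D) E v" and ?\<Delta> = "Max (set D)"
  have simple: "simple_graph {..<length D} E" using tree unfolding is_tree_def by simp
  have deg: "deg E w = D ! w" if "w < length D" for w
    using real that unfolding realizes_def by simp
  have posD: "0 < D ! w" if "w < length D" for w using pos that by simp
  have "1 < size ?l"
    using deg[of v] posD[of v] v \<open>deg E v \<noteq> 1\<close> by (simp add: size_nbr_degrees)
  then have "(\<Sum>j\<in>{j. 1 < j \<and> j \<le> ?\<Delta>}. count ?l j) \<le> 2"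
    using supp parts[of v] used[of v] v unfolding caterpillar_support_def Let_def
    by (metis lessThan_iff not_le)
  also have "(\<Sum>j\<in>{j. 1 < j \<and> j \<le> ?\<Delta>}. count ?l j) = size {#j \<in># ?l. 1 < j#}"
  proof -
    have "set_mset {#j \<in># ?l. 1 < j#} \<subseteq> {j. 1 < j \<and> j \<le> ?\<Delta>}"
      using parts[of v] v unfolding parts_le_def by auto
    then have "size {#j \<in># ?l. 1 < j#} = (\<Sum>j\<in>{j. 1 < j \<and> j \<le> ?\<Delta>}. count {#j \<in># ?l. 1 < j#} j)"
      unfolding size_multiset_overloaded_eq
      by (intro sum.mono_neutral_left) (auto simp: not_in_iff)
    then show ?thesis by simp
  qed
  also have "\<dots> = card {w \<in> nbrs E v. 1 < D ! w}"
    by (rule size_filter_nbr_degrees[OF finite_nbrs[OF simple]])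
  also have "{w \<in> nbrs E v. 1 < D ! w} = {w \<in> nbrs E v. deg E w \<noteq> 1}"
    using nbrs_subset[OF simple, of v] deg posD by fastforce
  finally show "card {w \<in> nbrs E v. deg E w \<noteq> 1} \<le> 2" .
qed

section \<open>From a tree to a solution\<close>

definition edges_of_type :: "('a \<Rightarrow> nat) \<Rightarrow> 'a set set \<Rightarrow> (nat \<times> nat) set \<Rightarrow> 'a set set" where
  "edges_of_type d E I = {e \<in> E. \<exists>v w. e = {v, w} \<and> pair_type (d v) (d w) \<in> I}"

lemma edge_of_type_iff: "{v, w} \<in> edges_of_type d E I \<longleftrightarrow> {v, w} \<in> E \<and> pair_type (d v) (d w) \<in> I"
  unfolding edges_of_type_def by (auto simp: doubleton_eq_iff pair_type_commute)

lemma total_demand_nbr_degrees: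
  assumes simple: "simple_graph V E"
  shows "total_demand V d (nbr_degrees d E) I = 2 * card (edges_of_type d E I)"
proof -
  let ?E = "edges_of_type d E I"
  have finV: "finite V" using simple unfolding simple_graph_def by simp
  have sub: "?E \<subseteq> E" unfolding edges_of_type_def by auto
  have "total_demand V d (nbr_degrees d E) I =
      (\<Sum>v\<in>V. card {w \<in> nbrs E v. pair_type (d v) (d w) \<in> I})"
    unfolding total_demand_def demand_def by (simp add: size_filter_nbr_degrees finite_nbrs[OF simple])
  also have "\<dots> = (\<Sum>v\<in>V. card {w. {v, w} \<in> ?E})"
    by (simp add: edge_of_type_iff nbrs_def)
  also have "\<dots> = card (SIGMA v:V. {w. {v, w} \<in> ?E})"
  proof (rule card_SigmaI[symmetric, OF finV])
    have "{w. {v, w} \<in> ?E} \<subseteq> V" for v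
      using sub simple_graph_edgeD(2)[OF simple] by blast
    then show "\<forall>v\<in>V. finite {w. {v, w} \<in> ?E}" using finV finite_subset by metis
  qed
  also have "(SIGMA v:V. {w. {v, w} \<in> ?E}) = {(v, w). {v, w} \<in> ?E}"
    using sub simple_graph_edgeD(1)[OF simple] by auto
  also have "card \<dots> = 2 * card ?E"
  proof -
    have "finite ?E" using finite_subset[OF sub] simple_graph_finite_edges[OF simple] by blast
    moreover have "\<forall>e\<in>?E. card e = 2" using sub simple unfolding simple_graph_def by blast
    ultimately show ?thesis using card_arcs by blast
  qed
  finally show ?thesis .
qed

text \<open>
  Counting directed edges makes the symmetry in \<open>i\<close> and \<open>j\<close> visible.
\<close>

lemma half_demand_nbr_degrees:
  assumes simple: "simple_graph V E"
  shows "half_demand V d (nbr_degrees d E) i j = card {(v, w). {v, w} \<in> E \<and> d v = i \<and> d w = j}"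
proof -
  have finV: "finite V" using simple unfolding simple_graph_def by simp
  have "half_demand V d (nbr_degrees d E) i j = (\<Sum>v\<in>{v \<in> V. d v = i}. card {w \<in> nbrs E v. d w = j})"
    unfolding half_demand_def
  proof (rule sum.cong[OF refl])
    fix v
    have "count (nbr_degrees d E v) j = size {#k \<in># nbr_degrees d E v. k = j#}"
      by (simp add: filter_eq_replicate_mset)
    then show "count (nbr_degrees d E v) j = card {w \<in> nbrs E v. d w = j}"
      by (simp add: size_filter_nbr_degrees finite_nbrs[OF simple])
  qed
  also have "\<dots> = card (SIGMA v:{v \<in> V. d v = i}. {w \<in> nbrs E v. d w = j})"
    by (rule card_SigmaI[symmetric]) (use finV finite_nbrs[OF simple] in auto)
  also have "(SIGMA v:{v \<in> V. d v = i}. {w \<in> nbrs E v. d w = j}) =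
      {(v, w). {v, w} \<in> E \<and> d v = i \<and> d w = j}"
    using simple_graph_edgeD(1)[OF simple] by (auto simp: nbrs_def)
  finally show ?thesis .
qed

lemma half_demand_nbr_degrees_commute:
  assumes "simple_graph V E"
  shows "half_demand V d (nbr_degrees d E) i j = half_demand V d (nbr_degrees d E) j i"
proof -
  have "bij_betw prod.swap {(v, w). {v, w} \<in> E \<and> d v = i \<and> d w = j}
      {(v, w). {v, w} \<in> E \<and> d v = j \<and> d w = i}"
    by (rule bij_betw_byWitness[where f' = prod.swap]) (auto simp: insert_commute)
  then show ?thesis unfolding half_demand_nbr_degrees[OF assms] by (rule bij_betw_same_card)
qed

text \<open>
  The edges with types in \<open>I\<close> form a forest whose vertices are the touched ones.
\<close>

lemma forest_demand_le:
  assumes simple: "simple_graph V E" and acyc: "\<nexists>vs. is_cycle E vs"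
    and ne: "touching V d (nbr_degrees d E) I \<noteq> {}"
  shows "total_demand V d (nbr_degrees d E) I + 2 \<le> 2 * card (touching V d (nbr_degrees d E) I)"
proof -
  let ?E = "edges_of_type d E I" and ?T = "touching V d (nbr_degrees d E) I"
  have sub: "?E \<subseteq> E" unfolding edges_of_type_def by auto
  have endpoint: "v \<in> ?T" if vw: "{v, w} \<in> E" "pair_type (d v) (d w) \<in> I" for v w
  proof -
    have "w \<in> nbrs E v" using vw by (simp add: nbrs_def)
    then have "d w \<in># nbr_degrees d E v"
      using finite_nbrs[OF simple, of v] by (simp add: nbr_degrees_def)
    then show ?thesis using simple_graph_edgeD(1)[OF simple vw(1)] vw(2) unfolding touching_iff by blast
  qed
  have "simple_graph ?T ?E"
    unfolding simple_graph_def
  proof (intro conjI ballI)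
    show "finite ?T" using simple unfolding simple_graph_def touching_def by simp
  next
    fix e assume e: "e \<in> ?E"
    then obtain v w where "e = {v, w}" "{v, w} \<in> E" "pair_type (d v) (d w) \<in> I"
      unfolding edges_of_type_def by blast
    then show "e \<subseteq> ?T"
      using endpoint[of v w] endpoint[of w v] pair_type_commute[of "d v" "d w"]
      by (simp add: insert_commute)
    show "card e = 2" using e sub simple unfolding simple_graph_def by blast
  qed
  moreover have "\<nexists>vs. is_cycle ?E vs" using acyc is_cycle_mono[OF _ sub] by blast
  ultimately have "card ?E + 1 \<le> card ?T" using ne by (rule acyclic_card_le)
  then show ?thesis unfolding total_demand_nbr_degrees[OF simple] by simp
qed

lemma tree_imp_tree_degree_sum:
  assumes tree: "is_tree {..<length D} E" and real: "realizes E D F"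
  shows "tree_degree_sum D"
proof -
  let ?V = "{..<length D}"
  have simple: "simple_graph ?V E" and conn: "connected_graph ?V E"
    and acyc: "\<nexists>vs. is_cycle E vs"
    using tree unfolding is_tree_def by auto
  have "?V \<noteq> {}" using conn unfolding connected_graph_def by simp
  then have card: "card E + 1 = length D"
    using connected_card_le[OF simple conn] acyclic_card_le[OF simple acyc] by simp
  have "sum_list D = (\<Sum>v\<in>?V. D ! v)" by (simp add: sum_list_sum_nth atLeast0LessThan)
  also have "\<dots> = (\<Sum>v\<in>?V. deg E v)" using real unfolding realizes_def by simp
  also have "\<dots> = total_demand ?V ((!) D) (nbr_degrees ((!) D) E) UNIV"
    by (simp add: total_demand_def demand_def size_nbr_degrees)
  also have "\<dots> = 2 * card E"
  proof -
    have "edges_of_type ((!) D) E UNIV = E"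
    proof (intro subset_antisym subsetI)
      fix e assume e: "e \<in> E"
      then obtain v w where "e = {v, w}"
        using simple unfolding simple_graph_def by (metis card_2_iff)
      then show "e \<in> edges_of_type ((!) D) E UNIV" using e by (simp add: edge_of_type_iff)
    qed (simp add: edges_of_type_def)
    then show ?thesis using total_demand_nbr_degrees[OF simple] by metis
  qed
  finally show ?thesis using card unfolding tree_degree_sum_def by simp
qed

text \<open>
  The solution counts the vertices by their multisets of neighbour degrees.
\<close>

lemma tree_imp_ip_solution:
  assumes nonempty: "D \<noteq> []" and pos: "\<forall>d\<in>set D. 0 < d"
    and tree: "is_tree {..<length D} E" and real: "realizes E D F"
  shows "\<exists>x p. ip_solution D F x p"
proof -
  let ?\<Delta> = "Max (set D)" and ?V = "{..<length D}" and ?d = "(!) D"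
  let ?L = "nbr_degrees ?d E"
  define x where "x l = int (card {v \<in> ?V. ?L v = l})" for l
  define p where "p i = int (half_demand ?V ?d ?L i i div 2)" for i
  have simple: "simple_graph ?V E" and acyc: "\<nexists>vs. is_cycle E vs"
    using tree unfolding is_tree_def by auto
  have deg: "deg E v = D ! v" "(\<Sum>w\<in>nbrs E v. deg E w) = F ! v" if "v \<in> ?V" for v
    using real that unfolding realizes_def by auto
  have bounds: "0 < D ! v" "D ! v \<le> ?\<Delta>" if "v \<in> ?V" for v
    using that pos nth_mem[of v D] by auto
  have size: "size (?L v) = D ! v" if "v \<in> ?V" for v
    using deg(1)[OF that] by (simp add: size_nbr_degrees)
  have part: "partition_of (?L v) (F ! v)" if "v \<in> ?V" for v
  proof -
    have "sum_mset (?L v) = (\<Sum>w\<in>nbrs E v. D ! w)"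
      unfolding nbr_degrees_def by (simp add: sum_unfold_sum_mset)
    also have "\<dots> = (\<Sum>w\<in>nbrs E v. deg E w)"
      using deg(1) nbrs_subset[OF simple, of v] by (intro sum.cong) auto
    finally have "sum_mset (?L v) = F ! v" using deg(2)[OF that] by simp
    moreover have "0 \<notin># ?L v"
      using bounds(1) nbrs_subset[OF simple, of v] finite_nbrs[OF simple, of v]
      by (fastforce simp: nbr_degrees_def)
    ultimately show ?thesis by (simp add: partition_of_def)
  qed
  have in_parts: "?L v \<in> parts_le ?\<Delta>" if v: "v \<in> ?V" for v
  proof -
    have "\<forall>j\<in>#?L v. j \<le> ?\<Delta>"
      using bounds(2) nbrs_subset[OF simple, of v] finite_nbrs[OF simple, of v]
      by (auto simp: nbr_degrees_def)
    then show ?thesis using part[OF v] size[OF v] bounds(2)[OF v] unfolding parts_le_def by auto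
  qed
  interpret neighbour_profile ?V ?d ?L ?\<Delta> x
    by unfold_locales (use in_parts size in \<open>auto simp: x_def\<close>)
  have "ip_solution D F x p"
    unfolding ip_solution_def Let_def
  proof (intro conjI allI impI ballI)
    fix d f
    let ?P = "{l \<in> parts_le ?\<Delta>. partition_of l f \<and> size l = d}"
    have "(\<Sum>l\<in>?P. x l) = (\<Sum>l\<in>parts_le ?\<Delta>. x l * of_bool (partition_of l f \<and> size l = d))"
      unfolding sum.inter_filter[OF finite_parts_le] by (intro sum.cong) auto
    also have "\<dots> = (\<Sum>v\<in>?V. of_bool (partition_of (?L v) f \<and> size (?L v) = d))"
      by (rule sum_over_vertices)
    also have "\<dots> = (\<Sum>v\<in>?V. of_bool (D ! v = d \<and> F ! v = f))"
      using part size by (intro sum.cong refl) (auto simp: partition_of_def)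
    also have "\<dots> = int (card {v. v < length D \<and> D ! v = d \<and> F ! v = f})"
      by (simp add: of_bool_def sum.If_cases Int_def)
    finally show "(\<Sum>l\<in>?P. x l) = int (y_count D F d f)" unfolding y_count_def .
  next
    fix l show "0 \<le> x l" by (simp add: x_def)
  next
    fix i j show "half_edges ?\<Delta> x i j = half_edges ?\<Delta> x j i"
      unfolding half_edges_eq using half_demand_nbr_degrees_commute[OF simple] by metis
  next
    fix i
    have "even (half_demand ?V ?d ?L i i)"
      using total_demand_pair_type[of ?V ?d ?L i i]
        total_demand_nbr_degrees[OF simple, of ?d "{pair_type i i}"] by fastforce
    then show "half_edges ?\<Delta> x i i = 2 * p i"
      unfolding half_edges_eq p_def by (metis dvd_mult_div_cancel of_nat_mult of_nat_numeral)
  next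
    fix I assume I: "I \<subseteq> pair_types ?\<Delta>" and inc: "incident ?\<Delta> x I \<noteq> 0"
    then have "touching ?V ?d ?L I \<noteq> {}" unfolding incident_eq[OF I] by auto
    then show "subset_ineq ?\<Delta> x I"
      unfolding subset_ineq_iff[OF I] by (rule forest_demand_le[OF simple acyc])
  qed
  then show ?thesis by blast
qed

theorem theorem21:
  fixes D F :: "nat list"
  assumes "D \<noteq> []" and "length F = length D"
    and "\<forall>d\<in>set D. 0 < d" and "\<forall>f\<in>set F. 0 < f"
  shows "(tree_realizable D F \<longleftrightarrow> tree_degree_sum D \<and> (\<exists>x p. ip_solution D F x p)) \<and>
    (tree_degree_sum D \<and> (\<exists>x p. ip_solution D F x p \<and> caterpillar_support D x)
       \<longrightarrow> caterpillar_realizable D F)"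
proof (intro conjI iffI impI)
  assume "tree_realizable D F"
  then obtain E where E: "is_tree {..<length D} E" "realizes E D F"
    unfolding tree_realizable_def by blast
  show "tree_degree_sum D" by (rule tree_imp_tree_degree_sum[OF E])
  show "\<exists>x p. ip_solution D F x p" by (rule tree_imp_ip_solution[OF assms(1,3) E])
next
  assume "tree_degree_sum D \<and> (\<exists>x p. ip_solution D F x p)"
  then obtain x p where "tree_degree_sum D" "ip_solution D F x p" by blast
  then show "tree_realizable D F"
    using ip_solution_imp_tree[OF assms(1,3)] unfolding tree_realizable_def by metis
next
  assume "tree_degree_sum D \<and> (\<exists>x p. ip_solution D F x p \<and> caterpillar_support D x)"
  then obtain x p where sum: "tree_degree_sum D" and sol: "ip_solution D F x p"
    and supp: "caterpillar_support D x" by blast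
  obtain E where E: "is_tree {..<length D} E" "realizes E D F"
    "\<And>v. v < length D \<Longrightarrow> nbr_degrees ((!) D) E v \<in> parts_le (Max (set D))"
    "\<And>v. v < length D \<Longrightarrow> x (nbr_degrees ((!) D) E v) \<noteq> 0"
    using ip_solution_imp_tree[OF assms(1,3) sum sol] by blast
  then have "is_caterpillar {..<length D} E"
    by (rule caterpillar_support_imp_caterpillar[OF assms(3) supp])
  then show "caterpillar_realizable D F"
    using E(2) unfolding caterpillar_realizable_def by blast
qed

end
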